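(* Let $\{A_n\}_n$ be a sequence of Hermitian matrices $A_n\in\mathbb{C}^{d_n\times d_n}$, with $(d_n)$ a monotonically increasing sequence of positive integers. Let $\{\{B_{n,t}\}_n\}_t$ be a generalized approximating class of sequences (g.a.c.s.) for $\{A_n\}_n$ in the Hermitian sense. Suppose that for every $t$ there are a measurable set $D_t\subseteq\mathbb{R}^d$ with $0<\mu(D_t)<\infty$ and a measurable Hermitian-valued $f_t:D_t\to\mathbb{C}^{p\times p}$ such that: (i) $\{B_{n,t}\}_n\sim_\lambda(f_t,D_t)$, i.e. $\lim_{n\to\infty}\sum_{j=1}^{d_{n,t}}\frac{F(\lambda_j(B_{n,t}))}{d_{n,t}}=\frac{1}{\mu(D_t)}\int_{D_t}\sum_{k=1}^p\frac{F(\lambda_k(f_t(s)))}{p}\,ds$ for all $F\in C_c(\mathbb{R})$; (ii) $D_t\subset D_{t+1}$ for all $t$; (iii) $D:=\bigcup_{t>0}D_t$ has finite measure; (iv) there is a measurable $f:D\to\mathbb{C}^{p\times p}$ such that $f_t^E\to f$ in measure as $t\to\infty$, where $f_t^E(s)=f_t(s)$ for $s\in D_t$ and $f_t^E(s)=0$ for $s\in D\setminus D_t$. Then $\{A_n\}_n\sim_\lambda(f,D)$, i.e. $$\lim_{n\to\infty}\sum_{j=1}^{d_n}\frac{F(\lambda_j(A_n))}{d_n}=\frac{1}{\mu(D)}\int_D\sum_{k=1}^p\frac{F(\lambda_k(f(s)))}{p}\,ds\qquad\forall F\in C_c(\mathbb{R}).$$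
   Context: $\mu$ is Lebesgue measure; $\lambda_j(X)$ denote eigenvalues of a Hermitian matrix $X$. Definition (g.a.c.s. in the Hermitian sense): $\{\{B_{n,t}\}_n\}_t$ with $B_{n,t}$ square Hermitian of size $d_{n,t}\le d_n$ is a generalized approximating class of sequences for $\{A_n\}_n$ if for every $t$ there exists $n_t$ such that for $n>n_t$ $$A_n=U_{n,t}\,(B_{n,t}\oplus 0_{n,t})\,U_{n,t}^*+R_{n,t}+N_{n,t},$$ where $0_{n,t}$ is the zero matrix of size $(d_n-d_{n,t})\times(d_n-d_{n,t})$, $U_{n,t}$ is unitary of order $d_n$, and $R_{n,t},N_{n,t}$ are $d_n\times d_n$ matrices with $\operatorname{rank}(R_{n,t})\le c(t)d_n$, $\|N_{n,t}\|\le\omega(t)$ (spectral norm), $d_n-d_{n,t}\le m(t)d_n$, and $\lim_{t\to\infty}c(t)=\lim_{t\to\infty}\omega(t)=\lim_{t\to\infty}m(t)=0$. *)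

theory Defs
  imports "HOL-Analysis.Analysis" "Jordan_Normal_Form.Schur_Decomposition"
    "Jordan_Normal_Form.DL_Rank" "Jordan_Normal_Form.Char_Poly" "HOL-Computational_Algebra.Fundamental_Theorem_Algebra"
begin

definition hermitian_mat :: "nat \<Rightarrow> complex mat \<Rightarrow> bool" where
  "hermitian_mat k A \<longleftrightarrow> A \<in> carrier_mat k k \<and> mat_adjoint A = A"

definition unitary_mat :: "nat \<Rightarrow> complex mat \<Rightarrow> bool" where
  "unitary_mat k U \<longleftrightarrow> U \<in> carrier_mat k k \<and> mat_adjoint U * U = 1\<^sub>m k"

definition vnorm2 :: "complex vec \<Rightarrow> real" where
  "vnorm2 v = sqrt (\<Sum>i<dim_vec v. (cmod (v $ i))\<^sup>2)"

definition spec_norm :: "complex mat \<Rightarrow> real" where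
  "spec_norm N = Sup {vnorm2 (N *\<^sub>v x) | x. x \<in> carrier_vec (dim_col N) \<and> vnorm2 x = 1}"

definition mat_rank :: "nat \<Rightarrow> complex mat \<Rightarrow> nat" where
  "mat_rank k R = vec_space.rank k R"

definition frob_norm :: "complex mat \<Rightarrow> real" where
  "frob_norm A = sqrt (\<Sum>i<dim_row A. \<Sum>j<dim_col A. (cmod (A $$ (i,j)))\<^sup>2)"

definition pad_zero :: "nat \<Rightarrow> complex mat \<Rightarrow> complex mat" where
  "pad_zero k B = four_block_mat B (0\<^sub>m (dim_row B) (k - dim_row B))
                     (0\<^sub>m (k - dim_row B) (dim_row B)) (0\<^sub>m (k - dim_row B) (k - dim_row B))"

text \<open>Sum over the eigenvalues (with algebraic multiplicity) of F(lambda_j(A)).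
  The eigenvalues are the roots of the characteristic polynomial; for a Hermitian
  matrix they are real, and we apply F to their real parts.\<close>

definition eig_sum :: "(real \<Rightarrow> complex) \<Rightarrow> complex mat \<Rightarrow> complex" where
  "eig_sum F A = sum_mset (image_mset (\<lambda>z. F (Re z)) (proots (char_poly A)))"

definition Cc :: "(real \<Rightarrow> complex) set" where
  "Cc = {F. continuous_on UNIV F \<and> compact (closure {x. F x \<noteq> 0})}"

text \<open>Generalized approximating class of sequences (Hermitian sense):
  B t n is the matrix B_{n,t}, of size dB t n; A n has size d n.\<close>

definition gacs_herm ::
  "(nat \<Rightarrow> nat \<Rightarrow> complex mat) \<Rightarrow> (nat \<Rightarrow> nat \<Rightarrow> nat) \<Rightarrow> (nat \<Rightarrow> complex mat) \<Rightarrow> (nat \<Rightarrow> nat) \<Rightarrow> bool"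
where
  "gacs_herm B dB A d \<longleftrightarrow>
    (\<forall>t n. hermitian_mat (dB t n) (B t n) \<and> dB t n \<le> d n) \<and>
    (\<exists>c \<omega> m :: nat \<Rightarrow> real. c \<longlonglongrightarrow> 0 \<and> \<omega> \<longlonglongrightarrow> 0 \<and> m \<longlonglongrightarrow> 0 \<and>
      (\<forall>t. \<exists>nt. \<forall>n>nt. \<exists>U R N.
          unitary_mat (d n) U \<and> R \<in> carrier_mat (d n) (d n) \<and> N \<in> carrier_mat (d n) (d n) \<and>
          A n = U * pad_zero (d n) (B t n) * mat_adjoint U + R + N \<and>
          real (mat_rank (d n) R) \<le> c t * real (d n) \<and>
          spec_norm N \<le> \<omega> t \<and>
          real (d n - dB t n) \<le> m t * real (d n)))"

definition mat_measurable_on :: "nat \<Rightarrow> 'a::euclidean_space set \<Rightarrow> ('a \<Rightarrow> complex mat) \<Rightarrow> bool" where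
  "mat_measurable_on p S f \<longleftrightarrow> (\<forall>s\<in>S. f s \<in> carrier_mat p p) \<and>
     (\<forall>i<p. \<forall>j<p. (\<lambda>s. f s $$ (i,j)) \<in> borel_measurable (restrict_space lebesgue S))"

end

theory Submission
  imports Defs
begin

text \<open>
  Let \<open>X\<close> and \<open>Y\<close> be Hermitian of size \<open>n\<close> and suppose that their quadratic forms differ by at most
  \<open>w |v|\<^sup>2\<close> on a subspace cut out by \<open>r\<close> linear equations; \<open>X - Y = R + N\<close> with \<open>rank R \<le> r\<close> and
  \<open>|N| \<le> w\<close> is such a case, and neither \<open>R\<close> nor \<open>N\<close> needs to be Hermitian. By a dimension count,
  \<open>X\<close> has at most \<open>r\<close> more eigenvalues in \<open>[x, \<infinity>)\<close> than \<open>Y\<close> has in \<open>[x - w, \<infinity>)\<close>. Integrating over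
  level sets, \<open>\<Sum> \<phi>(\<lambda>\<^sub>j X)\<close> and \<open>\<Sum> \<phi>(\<lambda>\<^sub>j Y)\<close> differ by at most \<open>n L w + r\<close> for every nondecreasing
  \<open>L\<close>-Lipschitz \<open>\<phi>\<close> with values in \<open>[0, 1]\<close>. Since a function in \<open>C\<^sub>c\<close> is a uniform limit of linear
  combinations of such ramps, its eigenvalue sums satisfy an estimate
  \<open>\<epsilon> n + C\<^sub>\<epsilon> (n w + r)\<close> with \<open>C\<^sub>\<epsilon>\<close> independent of \<open>n\<close>.

  This estimate is used twice: on the matrices, to compare \<open>A\<^sub>n\<close> with the padded \<open>B\<^bsub>n,t\<^esub>\<close>, and pointwise on the
  symbols with \<open>n = p\<close> and \<open>r = 0\<close>, where it gives measurability of the integrands and convergence of the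
  integrals from convergence in measure. The limit \<open>f\<close> is Hermitian only almost everywhere.
\<close>

section \<open>Spectral decomposition of Hermitian matrices\<close>

lemma dim_mat_adjoint [simp]:
  "dim_row (mat_adjoint A) = dim_col A" "dim_col (mat_adjoint A) = dim_row A"
  by (simp_all add: mat_adjoint_def)

lemma mat_adjoint_carrier [simp]:
  "A \<in> carrier_mat n m \<Longrightarrow> mat_adjoint A \<in> carrier_mat m n"
  by (rule carrier_matI) auto

lemma index_mat_adjoint [simp]:
  fixes A :: "complex mat"
  shows "i < dim_col A \<Longrightarrow> j < dim_row A \<Longrightarrow> mat_adjoint A $$ (i, j) = cnj (A $$ (j, i))"
  by (simp add: mat_adjoint_def mat_of_rows_index)

lemma mat_adjoint_adjoint [simp]: "mat_adjoint (mat_adjoint A) = (A :: complex mat)"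
  by (rule eq_matI) auto

lemma mat_adjoint_mult:
  fixes A B :: "complex mat"
  assumes "A \<in> carrier_mat n k" "B \<in> carrier_mat k m"
  shows "mat_adjoint (A * B) = mat_adjoint B * mat_adjoint A"
  using assms by (intro eq_matI) (auto simp: scalar_prod_def mult.commute intro!: sum.cong)

lemma mat_adjoint_one [simp]: "mat_adjoint (1\<^sub>m n :: complex mat) = 1\<^sub>m n"
  by (rule eq_matI) auto

lemma hermitian_mat_index:
  assumes "hermitian_mat n A" "i < n" "j < n"
  shows "A $$ (i, j) = cnj (A $$ (j, i))"
  using assms index_mat_adjoint[of i A j] by (auto simp: hermitian_mat_def)

lemma hermitian_mat_conj:
  assumes A: "hermitian_mat n A" and U: "U \<in> carrier_mat n m"
  shows "hermitian_mat m (mat_adjoint U * A * U)"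
proof -
  have Ac: "A \<in> carrier_mat n n" and Aa: "mat_adjoint A = A"
    using A by (auto simp: hermitian_mat_def)
  have "mat_adjoint (mat_adjoint U * A * U) = mat_adjoint U * (mat_adjoint A * mat_adjoint (mat_adjoint U))"
    using mat_adjoint_mult[OF mult_carrier_mat[OF mat_adjoint_carrier[OF U] Ac] U]
      mat_adjoint_mult[OF mat_adjoint_carrier[OF U] Ac] by simp
  also have "\<dots> = mat_adjoint U * A * U"
    using Ac U Aa by (simp add: assoc_mult_mat[of _ m n _ n _ m])
  finally show ?thesis
    using Ac U by (auto simp: hermitian_mat_def)
qed

lemma unitary_mat_right_inverse:
  assumes "unitary_mat n U"
  shows "U * mat_adjoint U = 1\<^sub>m n"
  using assms mat_mult_left_right_inverse[of "mat_adjoint U" n U] by (auto simp: unitary_mat_def)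

lemma unitary_mat_mult:
  assumes U: "unitary_mat n U" and V: "unitary_mat n V"
  shows "unitary_mat n (U * V)"
proof -
  have c: "U \<in> carrier_mat n n" "V \<in> carrier_mat n n"
    and u: "mat_adjoint U * U = 1\<^sub>m n" "mat_adjoint V * V = 1\<^sub>m n"
    using U V by (auto simp: unitary_mat_def)
  have "mat_adjoint (U * V) * (U * V) = mat_adjoint V * ((mat_adjoint U * U) * V)"
    using c by (simp add: mat_adjoint_mult[of _ n n _ n] assoc_mult_mat[of _ n n _ n _ n])
  then show ?thesis using c u by (simp add: unitary_mat_def)
qed

text \<open>Complete \<open>v\<close> to a basis and orthogonalise: Gram-Schmidt keeps the first
  vector, so after normalisation column 0 is a multiple of \<open>v\<close>. This is the deflation
  step of the spectral theorem, where \<open>v\<close> is an eigenvector.\<close>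

lemma unitary_mat_extend:
  fixes v :: "complex vec"
  assumes v: "v \<in> carrier_vec n" and v0: "v \<noteq> 0\<^sub>v n" and n: "n \<noteq> 0"
  shows "\<exists>U a. unitary_mat n U \<and> col U 0 = a \<cdot>\<^sub>v v"
proof -
  interpret cof_vec_space n "TYPE(complex)" .
  define b where "b = basis_completion v"
  define ws where "ws = gram_schmidt n b"
  from basis_completion[OF v v0, folded b_def]
  have dist_b: "distinct b" and indep: "\<not> lin_dep (set b)" and b: "set b \<subseteq> carrier_vec n"
    and hdb: "hd b = v" and len_b: "length b = n" by auto
  from hdb len_b n obtain vs where bv: "b = v # vs" by (cases b) auto
  from gram_schmidt_result[OF b dist_b indep refl, folded ws_def]
  have ws: "set ws \<subseteq> carrier_vec n" "corthogonal ws" "length ws = n"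
    by (auto simp: len_b)
  have "hd ws = v" using gram_schmidt_hd[OF v, of vs, folded bv] unfolding ws_def .
  then have ws0: "ws ! 0 = v" using ws(3) n by (cases ws) auto
  have wsc: "ws ! i \<in> carrier_vec n" if "i < n" for i using ws that by auto
  \<comment> \<open>\<open>gram_schmidt\<close> orthogonalises without normalising, so the columns
    are rescaled here. The division is legitimate because \<open>corthogonal\<close> includes that
    no \<open>ws ! i\<close> has vanishing square.\<close>
  define c where "c i = (1 / complex_of_real (vnorm2 (ws ! i)))" for i
  define U where "U = mat n n (\<lambda>(i, j). c j * (ws ! j) $ i)"
  have Uc: "U \<in> carrier_mat n n" by (simp add: U_def)
  have "mat_adjoint U * U = 1\<^sub>m n"
  proof (rule eq_matI)
    fix i j assume ij: "i < dim_row (1\<^sub>m n :: complex mat)" "j < dim_col (1\<^sub>m n :: complex mat)"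
    have ip: "ws ! j \<bullet>c ws ! i = (\<Sum>k<n. (ws ! j) $ k * cnj ((ws ! i) $ k))"
      using wsc[of i] wsc[of j] ij by (auto simp: scalar_prod_def atLeast0LessThan)
    have e: "(mat_adjoint U * U) $$ (i, j) = cnj (c i) * c j * (ws ! j \<bullet>c ws ! i)"
      using ij unfolding ip
      by (simp add: U_def scalar_prod_def atLeast0LessThan sum_distrib_left mult_ac)
    show "(mat_adjoint U * U) $$ (i, j) = 1\<^sub>m n $$ (i, j)"
    proof (cases "i = j")
      case False
      then have "ws ! j \<bullet>c ws ! i = 0" using corthogonalD[OF ws(2)] ij ws(3) by auto
      then show ?thesis using e False ij by simp
    next
      case True
      have nz: "ws ! i \<bullet>c ws ! i \<noteq> 0" using corthogonalD[OF ws(2)] ij ws(3) by auto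
      have "ws ! i \<bullet>c ws ! i = complex_of_real (\<Sum>k<n. (cmod ((ws ! i) $ k))\<^sup>2)"
        unfolding of_real_sum complex_norm_square using ip True by simp
      also have "\<dots> = complex_of_real (vnorm2 (ws ! i)) ^ 2"
        unfolding of_real_power[symmetric] vnorm2_def using wsc[of i] ij
        by (subst real_sqrt_pow2) (auto intro: sum_nonneg)
      finally show ?thesis using nz e True ij
        by (simp add: c_def power2_eq_square field_simps)
    qed
  qed (auto simp: U_def)
  moreover have "col U 0 = c 0 \<cdot>\<^sub>v v"
    using v n by (intro eq_vecI) (auto simp: U_def ws0)
  ultimately show ?thesis using Uc by (auto simp: unitary_mat_def)
qed

definition real_diag :: "nat \<Rightarrow> (nat \<Rightarrow> real) \<Rightarrow> complex mat" where
  "real_diag n a = mat n n (\<lambda>(i, j). if i = j then complex_of_real (a i) else 0)"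

lemma real_diag_carrier [simp]: "real_diag n a \<in> carrier_mat n n"
  by (simp add: real_diag_def)

lemma dim_real_diag [simp]: "dim_row (real_diag n a) = n" "dim_col (real_diag n a) = n"
  by (simp_all add: real_diag_def)

lemma mult_block_diag:
  fixes A1 A2 D1 D2 :: "complex mat"
  assumes "A1 \<in> carrier_mat n n" "A2 \<in> carrier_mat n n" "D1 \<in> carrier_mat m m" "D2 \<in> carrier_mat m m"
  shows "four_block_mat A1 (0\<^sub>m n m) (0\<^sub>m m n) D1 * four_block_mat A2 (0\<^sub>m n m) (0\<^sub>m m n) D2
    = four_block_mat (A1 * A2) (0\<^sub>m n m) (0\<^sub>m m n) (D1 * D2)"
  using mult_four_block_mat[OF assms(1) zero_carrier_mat zero_carrier_mat assms(3)
      assms(2) zero_carrier_mat zero_carrier_mat assms(4)] assms by simp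

lemma unitary_mat_four_block:
  assumes U: "unitary_mat n U" and V: "unitary_mat m V"
  shows "unitary_mat (n + m) (four_block_mat U (0\<^sub>m n m) (0\<^sub>m m n) V)"
    and "mat_adjoint (four_block_mat U (0\<^sub>m n m) (0\<^sub>m m n) V)
      = four_block_mat (mat_adjoint U) (0\<^sub>m n m) (0\<^sub>m m n) (mat_adjoint V)"
proof -
  have c: "U \<in> carrier_mat n n" "V \<in> carrier_mat m m"
    and u: "mat_adjoint U * U = 1\<^sub>m n" "mat_adjoint V * V = 1\<^sub>m m"
    using U V by (auto simp: unitary_mat_def)
  show a: "mat_adjoint (four_block_mat U (0\<^sub>m n m) (0\<^sub>m m n) V)
      = four_block_mat (mat_adjoint U) (0\<^sub>m n m) (0\<^sub>m m n) (mat_adjoint V)"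
    using c by (intro eq_matI) auto
  show "unitary_mat (n + m) (four_block_mat U (0\<^sub>m n m) (0\<^sub>m m n) V)"
    unfolding unitary_mat_def a using c u
    by (simp add: mult_block_diag)
qed

lemma four_block_real_diag:
  "four_block_mat (real_diag n a) (0\<^sub>m n m) (0\<^sub>m m n) (real_diag m b)
    = real_diag (n + m) (\<lambda>i. if i < n then a i else b (i - n))"
  by (rule eq_matI) (auto simp: real_diag_def)

text \<open>Deflation. With a normalised eigenvector as first column of \<open>U\<close>, the
  conjugated matrix \<open>B\<close> has first column \<open>e\<close> times a unit vector.
  Hermitian symmetry clears the first row as well and leaves a Hermitian block \<open>C\<close> of
  size \<open>n\<close> for the induction hypothesis.\<close>

lemma spectral_theorem:
  assumes "hermitian_mat n A"
  shows "\<exists>U a. unitary_mat n U \<and> A = U * real_diag n a * mat_adjoint U"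
  using assms
proof (induction n arbitrary: A)
  case 0
  then have "A \<in> carrier_mat 0 0" by (simp add: hermitian_mat_def)
  then have "unitary_mat 0 (1\<^sub>m 0)" "A = 1\<^sub>m 0 * real_diag 0 a * mat_adjoint (1\<^sub>m 0)" for a
    by (auto simp: unitary_mat_def intro!: eq_matI)
  then show ?case by blast
next
  case (Suc n)
  let ?n = "Suc n"
  have Ac: "A \<in> carrier_mat ?n ?n" using Suc.prems by (simp add: hermitian_mat_def)
  obtain es where es: "char_poly A = (\<Prod>a\<leftarrow>es. [:- a, 1:])" "length es = ?n"
    using char_poly_factorized[OF Ac] by blast
  then obtain e es' where "es = e # es'" by (cases es) auto
  then have "poly (char_poly A) e = 0" using es by simp
  then have "eigenvalue A e" using eigenvalue_root_char_poly[OF Ac] by simp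
  then obtain v where v: "v \<in> carrier_vec ?n" "v \<noteq> 0\<^sub>v ?n" "A *\<^sub>v v = e \<cdot>\<^sub>v v"
    using Ac by (auto simp: eigenvalue_def eigenvector_def)
  obtain U a where U: "unitary_mat ?n U" and U0: "col U 0 = a \<cdot>\<^sub>v v"
    using unitary_mat_extend[OF v(1,2)] by blast
  have Uc: "U \<in> carrier_mat ?n ?n" and UU: "mat_adjoint U * U = 1\<^sub>m ?n"
    using U by (auto simp: unitary_mat_def)
  define B where "B = mat_adjoint U * A * U"
  have Bh: "hermitian_mat ?n B" unfolding B_def by (rule hermitian_mat_conj[OF Suc.prems Uc])
  then have Bc: "B \<in> carrier_mat ?n ?n" by (simp add: hermitian_mat_def)
  have AU: "A *\<^sub>v col U 0 = e \<cdot>\<^sub>v col U 0"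
    unfolding U0 using v Ac by (simp add: mult_mat_vec[of A ?n ?n] smult_smult_assoc mult.commute)
  have "col B 0 = mat_adjoint U *\<^sub>v (A *\<^sub>v col U 0)"
  proof -
    have "col B 0 = col (mat_adjoint U * (A * U)) 0"
      unfolding B_def using Ac Uc by (simp add: assoc_mult_mat[of _ ?n ?n _ ?n _ ?n])
    also have "\<dots> = mat_adjoint U *\<^sub>v (A *\<^sub>v col U 0)"
      using Ac Uc by (subst col_mult2[of _ ?n ?n _ ?n]) (auto simp: col_mult2[of A ?n ?n U ?n] simp del: col_mult)
    finally show ?thesis .
  qed
  also have "\<dots> = e \<cdot>\<^sub>v (mat_adjoint U *\<^sub>v col U 0)"
    unfolding AU using Uc by (intro mult_mat_vec[of _ ?n ?n]) (auto intro!: carrier_vecI)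
  also have "mat_adjoint U *\<^sub>v col U 0 = col (mat_adjoint U * U) 0"
    using Uc by (simp add: col_mult2[of _ ?n ?n _ ?n])
  also have "\<dots> = unit_vec ?n 0" unfolding UU by simp
  finally have colB: "col B 0 = e \<cdot>\<^sub>v unit_vec ?n 0" .
  have B0: "B $$ (i, 0) = (if i = 0 then e else 0)" if "i < ?n" for i
    using arg_cong[OF colB, of "\<lambda>v. v $ i"] that Bc by auto
  have B0': "B $$ (0, i) = (if i = 0 then e else 0)" if "i < ?n" for i
    using hermitian_mat_index[OF Bh, of 0 i] B0[of 0] B0[of i] that
      hermitian_mat_index[OF Bh, of 0 0] by auto
  \<comment> \<open>The eigenvalue is real because it is a diagonal entry of the Hermitian matrix
    \<open>B\<close>.\<close>
  have er: "e = complex_of_real (Re e)"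
    using hermitian_mat_index[OF Bh, of 0 0] B0[of 0] by (auto simp: complex_eq_iff)
  define C where "C = mat n n (\<lambda>(i, j). B $$ (Suc i, Suc j))"
  have "hermitian_mat n C"
    unfolding hermitian_mat_def
    by (auto simp: C_def intro!: eq_matI hermitian_mat_index[OF Bh, symmetric])
  from Suc.IH[OF this] obtain V b where V: "unitary_mat n V"
    and C: "C = V * real_diag n b * mat_adjoint V" by blast
  have Vc: "V \<in> carrier_mat n n" using V by (simp add: unitary_mat_def)
  let ?z = "0\<^sub>m 1 n :: complex mat" and ?z' = "0\<^sub>m n 1 :: complex mat"
  let ?E = "real_diag 1 (\<lambda>_. Re e)"
  let ?D = "four_block_mat ?E ?z ?z' (real_diag n b)"
  have one: "unitary_mat 1 (1\<^sub>m 1)" by (auto simp: unitary_mat_def intro!: eq_matI)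
  define W where "W = four_block_mat (1\<^sub>m 1) ?z ?z' V"
  have W: "unitary_mat ?n W" and Wa: "mat_adjoint W = four_block_mat (1\<^sub>m 1) ?z ?z' (mat_adjoint V)"
    using unitary_mat_four_block[OF one V] by (simp_all add: W_def)
  have Wc: "W \<in> carrier_mat ?n ?n" using W by (simp add: unitary_mat_def)
  have "B = four_block_mat ?E ?z ?z' C"
    using Bc B0 B0' er by (intro eq_matI) (auto simp: C_def real_diag_def)
  also have "\<dots> = W * ?D * mat_adjoint W"
    unfolding Wa unfolding W_def C using Vc
    by (simp add: mult_block_diag left_mult_one_mat[of _ 1 1] right_mult_one_mat[of _ 1 1])
  also have "?D = real_diag ?n (\<lambda>i. if i < 1 then Re e else b (i - 1))"
    using four_block_real_diag[of 1 "\<lambda>_. Re e" n b] by simp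
  finally obtain g where B: "B = W * real_diag ?n g * mat_adjoint W" by blast
  have "A = (U * mat_adjoint U) * A * (U * mat_adjoint U)"
    using unitary_mat_right_inverse[OF U] Ac by simp
  also have "\<dots> = U * B * mat_adjoint U"
    unfolding B_def using Ac Uc
    by (simp add: assoc_mult_mat[of _ ?n ?n _ ?n _ ?n] mult_carrier_mat[of _ ?n ?n _ ?n])
  also have "\<dots> = (U * W) * real_diag ?n g * mat_adjoint (U * W)"
    unfolding B using Uc Wc
    by (simp add: assoc_mult_mat[of _ ?n ?n _ ?n _ ?n] mult_carrier_mat[of _ ?n ?n _ ?n]
        mat_adjoint_mult[of _ ?n ?n _ ?n])
  finally show ?case using unitary_mat_mult[OF U W] by blast
qed

section \<open>Eigenvalue sums as sums over diagonal entries\<close>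

lemma char_poly_real_diag:
  "char_poly (real_diag n a) = (\<Prod>x\<leftarrow>map (complex_of_real \<circ> a) [0..<n]. [:- x, 1:])"
proof -
  have "upper_triangular (real_diag n a)" by (auto simp: real_diag_def)
  from char_poly_upper_triangular[OF real_diag_carrier this]
  have "char_poly (real_diag n a) = (\<Prod>x\<leftarrow>diag_mat (real_diag n a). [:- x, 1:])" .
  also have "diag_mat (real_diag n a) = map (complex_of_real \<circ> a) [0..<n]"
    by (auto simp: diag_mat_def real_diag_def)
  finally show ?thesis .
qed

lemma proots_linear_factors: "proots (\<Prod>x\<leftarrow>xs. [:- x, 1:]) = mset (xs :: complex list)"
proof (induction xs)
  case (Cons x xs)
  have "(\<Prod>x\<leftarrow>xs. [:- x, 1:]) \<noteq> 0" by (auto simp: prod_list_zero_iff)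
  then show ?case using Cons by (simp add: proots_mult proots_linear_factor del: mult_pCons_left)
qed simp

text \<open>Similar matrices share their characteristic polynomial, and that of a diagonal matrix
  splits into linear factors given by its entries. From here on the multiset of roots in
  \<open>eig_sum\<close> is replaced by an indexed family.\<close>

lemma eig_sum_unitary_diag:
  assumes U: "unitary_mat n U"
  shows "eig_sum F (U * real_diag n a * mat_adjoint U) = (\<Sum>i<n. F (a i))"
proof -
  have c: "U \<in> carrier_mat n n" and u: "mat_adjoint U * U = 1\<^sub>m n"
    using U by (auto simp: unitary_mat_def)
  have "similar_mat_wit (U * real_diag n a * mat_adjoint U) (real_diag n a) U (mat_adjoint U)"
    using c u unitary_mat_right_inverse[OF U]
    by (intro similar_mat_witI[of _ _ n]) auto
  then have "char_poly (U * real_diag n a * mat_adjoint U) = char_poly (real_diag n a)"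
    by (intro char_poly_similar) (auto simp: similar_mat_def)
  then have "proots (char_poly (U * real_diag n a * mat_adjoint U)) = mset (map (complex_of_real \<circ> a) [0..<n])"
    unfolding char_poly_real_diag by (simp only: proots_linear_factors)
  then have "eig_sum F (U * real_diag n a * mat_adjoint U) = (\<Sum>i\<in>#mset [0..<n]. F (a i))"
    by (simp add: eig_sum_def image_mset.compositionality comp_def del: mset_upt)
  then show ?thesis
    by (simp add: sum_unfold_sum_mset atLeast0LessThan)
qed

section \<open>Perturbation of eigenvalue counts\<close>

text \<open>Filling up the equations with zero rows gives a square matrix, which is singular because
  at least one zero row occurs.\<close>

lemma homogeneous_system_nonzero_solution:
  fixes rs :: "complex vec list"
  assumes rs: "set rs \<subseteq> carrier_vec n" and len: "length rs < n"
  shows "\<exists>v\<in>carrier_vec n. v \<noteq> 0\<^sub>v n \<and> (\<forall>r\<in>set rs. r \<bullet> v = 0)"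
proof -
  define g where "g i = (if i < length rs then rs ! i else 0\<^sub>v n)" for i
  \<comment> \<open>Row \<open>length rs\<close> is below \<open>n\<close> because there are fewer
    equations than unknowns; it is written as an explicit zero to match
    \<open>det_row_0\<close>.\<close>
  define M where "M = mat\<^sub>r n n (\<lambda>i. if i = length rs then 0\<^sub>v n else g i)"
  have g: "g i \<in> carrier_vec n" for i using rs by (auto simp: g_def)
  have "det M = 0" unfolding M_def using len g by (intro det_row_0) auto
  moreover have M: "M \<in> carrier_mat n n" by (simp add: M_def)
  ultimately obtain v where v: "v \<in> carrier_vec n" "v \<noteq> 0\<^sub>v n" "M *\<^sub>v v = 0\<^sub>v n"
    using det_0_iff_vec_prod_zero_field by blast
  have "rs ! i \<bullet> v = 0" if i: "i < length rs" for i
  proof -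
    have "row M i = rs ! i"
      using i len g[of i] by (simp add: M_def g_def)
    then show ?thesis using arg_cong[OF v(3), of "\<lambda>x. x $ i"] i len M by simp
  qed
  then show ?thesis using v by (metis in_set_conv_nth)
qed

section \<open>Norms and quadratic forms in an orthonormal eigenbasis\<close>

lemma vnorm2_nonneg [simp]: "vnorm2 v \<ge> 0"
  by (simp add: vnorm2_def sum_nonneg)

lemma vnorm2_squared: "v \<in> carrier_vec n \<Longrightarrow> (vnorm2 v)\<^sup>2 = (\<Sum>i<n. (cmod (v $ i))\<^sup>2)"
  by (simp add: vnorm2_def sum_nonneg)

lemma vnorm2_pos: "v \<in> carrier_vec n \<Longrightarrow> v \<noteq> 0\<^sub>v n \<Longrightarrow> vnorm2 v > 0"
proof -
  assume v: "v \<in> carrier_vec n" "v \<noteq> 0\<^sub>v n"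
  then obtain i where "i < n" "v $ i \<noteq> 0" by (metis carrier_vecD eq_vecI index_zero_vec)
  then have "(\<Sum>i<n. (cmod (v $ i))\<^sup>2) > 0" by (intro sum_pos2[of _ i]) auto
  then show ?thesis using v by (simp add: vnorm2_def)
qed

lemma cscalar_prod_self:
  "v \<in> carrier_vec n \<Longrightarrow> v \<bullet>c v = complex_of_real (\<Sum>i<n. (cmod (v $ i))\<^sup>2)"
  unfolding of_real_sum complex_norm_square by (simp add: scalar_prod_def atLeast0LessThan)

lemma cscalar_prod_adjoint:
  fixes A :: "complex mat"
  assumes A: "A \<in> carrier_mat n m" and x: "x \<in> carrier_vec m" and y: "y \<in> carrier_vec n"
  shows "(A *\<^sub>v x) \<bullet>c y = x \<bullet>c (mat_adjoint A *\<^sub>v y)"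
proof -
  have "(A *\<^sub>v x) \<bullet>c y = (\<Sum>i<n. \<Sum>j<m. A $$ (i, j) * x $ j * cnj (y $ i))"
    using A x y by (simp add: scalar_prod_def atLeast0LessThan sum_distrib_right)
  also have "\<dots> = (\<Sum>j<m. \<Sum>i<n. A $$ (i, j) * x $ j * cnj (y $ i))"
    by (rule sum.swap)
  also have "\<dots> = x \<bullet>c (mat_adjoint A *\<^sub>v y)"
    using A x y by (simp add: scalar_prod_def atLeast0LessThan sum_distrib_left mult_ac)
  finally show ?thesis .
qed

text \<open>Parseval: the entries of \<open>mat_adjoint U *\<^sub>v v\<close> are the coordinates of
  \<open>v\<close> in the orthonormal basis formed by the columns of \<open>U\<close>.\<close>

lemma unitary_mat_vnorm2:
  assumes U: "unitary_mat n U" and v: "v \<in> carrier_vec n"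
  shows "(vnorm2 v)\<^sup>2 = (\<Sum>i<n. (cmod ((mat_adjoint U *\<^sub>v v) $ i))\<^sup>2)"
proof -
  have Uc: "U \<in> carrier_mat n n" using U by (simp add: unitary_mat_def)
  let ?c = "mat_adjoint U *\<^sub>v v"
  have c: "?c \<in> carrier_vec n" using Uc v by (intro mult_mat_vec_carrier[of _ n n]) auto
  have "U *\<^sub>v ?c = (U * mat_adjoint U) *\<^sub>v v"
    using Uc v by (intro assoc_mult_mat_vec[symmetric, of _ n n _ n]) auto
  then have "v = U *\<^sub>v ?c" using unitary_mat_right_inverse[OF U] v by simp
  then have "v \<bullet>c v = ?c \<bullet>c ?c" using cscalar_prod_adjoint[OF Uc c v] by simp
  then have "complex_of_real ((vnorm2 v)\<^sup>2) = complex_of_real (\<Sum>i<n. (cmod (?c $ i))\<^sup>2)"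
    using cscalar_prod_self[OF v] cscalar_prod_self[OF c] vnorm2_squared[OF v] by simp
  then show ?thesis using of_real_eq_iff by blast
qed

lemma real_diag_form:
  assumes c: "c \<in> carrier_vec n"
  shows "(real_diag n a *\<^sub>v c) \<bullet>c c = complex_of_real (\<Sum>i<n. a i * (cmod (c $ i))\<^sup>2)"
proof -
  have "(real_diag n a *\<^sub>v c) \<bullet>c c = (\<Sum>i<n. (real_diag n a *\<^sub>v c) $ i * cnj (c $ i))"
    using c by (simp add: scalar_prod_def[of _ "conjugate _"] atLeast0LessThan)
  also have "\<dots> = (\<Sum>i<n. complex_of_real (a i) * (c $ i * cnj (c $ i)))"
  proof (rule sum.cong)
    fix i assume i: "i \<in> {..<n}"
    have "(real_diag n a *\<^sub>v c) $ i = (\<Sum>j<n. real_diag n a $$ (i, j) * c $ j)"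
      using c i by (simp add: scalar_prod_def atLeast0LessThan)
    also have "\<dots> = (\<Sum>j<n. if j = i then complex_of_real (a i) * c $ i else 0)"
      using i by (intro sum.cong) (auto simp: real_diag_def)
    also have "\<dots> = complex_of_real (a i) * c $ i" using i by simp
    finally show "(real_diag n a *\<^sub>v c) $ i * cnj (c $ i) = complex_of_real (a i) * (c $ i * cnj (c $ i))"
      by simp
  qed simp
  also have "\<dots> = complex_of_real (\<Sum>i<n. a i * (cmod (c $ i))\<^sup>2)"
    unfolding of_real_sum of_real_mult complex_norm_square by simp
  finally show ?thesis .
qed

lemma unitary_diag_form:
  assumes U: "unitary_mat n U" and v: "v \<in> carrier_vec n"
  shows "((U * real_diag n a * mat_adjoint U) *\<^sub>v v) \<bullet>c v
    = complex_of_real (\<Sum>i<n. a i * (cmod ((mat_adjoint U *\<^sub>v v) $ i))\<^sup>2)"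
proof -
  have Uc: "U \<in> carrier_mat n n" using U by (simp add: unitary_mat_def)
  let ?c = "mat_adjoint U *\<^sub>v v"
  have c: "?c \<in> carrier_vec n" using Uc v by (intro mult_mat_vec_carrier[of _ n n]) auto
  have "(U * real_diag n a * mat_adjoint U) *\<^sub>v v = U *\<^sub>v (real_diag n a *\<^sub>v ?c)"
    using assoc_mult_mat_vec[of "U * real_diag n a" n n "mat_adjoint U" n v]
      assoc_mult_mat_vec[of U n n "real_diag n a" n ?c] Uc v c by simp
  then have "((U * real_diag n a * mat_adjoint U) *\<^sub>v v) \<bullet>c v = (real_diag n a *\<^sub>v ?c) \<bullet>c ?c"
    using cscalar_prod_adjoint[OF Uc mult_mat_vec_carrier[OF real_diag_carrier c] v] by simp
  then show ?thesis using real_diag_form[OF c] by simp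
qed

text \<open>The rows of \<open>W\<close> are the \<open>r\<close> linear equations. Unlike a splitting of \<open>X - Y\<close> into a low rank and a
  small norm part, this relation is evidently symmetric in \<open>X\<close> and \<open>Y\<close>.\<close>

definition forms_close :: "nat \<Rightarrow> nat \<Rightarrow> real \<Rightarrow> complex mat \<Rightarrow> complex mat \<Rightarrow> bool" where
  "forms_close n r w X Y \<longleftrightarrow> (\<exists>W\<in>carrier_mat r n. \<forall>v\<in>carrier_vec n. W *\<^sub>v v = 0\<^sub>v r \<longrightarrow>
     cmod ((X *\<^sub>v v) \<bullet>c v - (Y *\<^sub>v v) \<bullet>c v) \<le> w * (vnorm2 v)\<^sup>2)"

lemma forms_close_sym: "forms_close n r w X Y \<Longrightarrow> forms_close n r w Y X"
  by (simp add: forms_close_def norm_minus_commute)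

text \<open>Otherwise some nonzero \<open>v\<close> lies in the span of the eigenvectors of \<open>X\<close> to eigenvalues at least \<open>x\<close>, is
  orthogonal to those of \<open>Y\<close> to eigenvalues at least \<open>x - w\<close>, and satisfies \<open>W v = 0\<close>; the quadratic forms
  at this \<open>v\<close> then differ by more than \<open>w |v|\<^sup>2\<close>.\<close>

lemma card_eigenvalues_ge_le:
  assumes U: "unitary_mat n U" and V: "unitary_mat n V"
    and close: "forms_close n r w (U * real_diag n a * mat_adjoint U) (V * real_diag n b * mat_adjoint V)"
  shows "card {i. i < n \<and> a i \<ge> x} \<le> card {i. i < n \<and> b i \<ge> x - w} + r"
proof (rule ccontr)
  assume neg: "\<not> ?thesis"
  let ?X = "U * real_diag n a * mat_adjoint U" and ?Y = "V * real_diag n b * mat_adjoint V"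
  have Uc: "U \<in> carrier_mat n n" and Vc: "V \<in> carrier_mat n n" using U V by (auto simp: unitary_mat_def)
  obtain W where W: "W \<in> carrier_mat r n" and cl: "\<And>v. v \<in> carrier_vec n \<Longrightarrow> W *\<^sub>v v = 0\<^sub>v r \<Longrightarrow>
     cmod ((?X *\<^sub>v v) \<bullet>c v - (?Y *\<^sub>v v) \<bullet>c v) \<le> w * (vnorm2 v)\<^sup>2"
    using close by (auto simp: forms_close_def)
  \<comment> \<open>Being annihilated by \<open>r1\<close> puts \<open>v\<close> in the span of the
    eigenvectors of \<open>?X\<close> to eigenvalues at least \<open>x\<close>; being annihilated by
    \<open>r2\<close> makes it orthogonal to the eigenvectors of \<open>?Y\<close> to eigenvalues at
    least \<open>x - w\<close>.\<close>
  define r1 where "r1 = map (row (mat_adjoint U)) (filter (\<lambda>i. a i < x) [0..<n])"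
  define r2 where "r2 = map (row (mat_adjoint V)) (filter (\<lambda>i. b i \<ge> x - w) [0..<n])"
  have l1: "length r1 = card {i. i < n \<and> a i < x}"
    by (simp add: r1_def length_filter_conv_card) (rule arg_cong[where f = card], auto)
  have l2: "length r2 = card {i. i < n \<and> b i \<ge> x - w}"
    by (simp add: r2_def length_filter_conv_card) (rule arg_cong[where f = card], auto)
  have "card {i. i < n \<and> a i \<ge> x} + card {i. i < n \<and> a i < x}
      = card ({i. i < n \<and> a i \<ge> x} \<union> {i. i < n \<and> a i < x})"
    by (rule card_Un_disjoint[symmetric]) auto
  also have "{i. i < n \<and> a i \<ge> x} \<union> {i. i < n \<and> a i < x} = {..<n}" by auto
  \<comment> \<open>The failed inequality says exactly that the
    \<open>n - card {i. i < n \<and> a i \<ge> x}\<close> equations of \<open>r1\<close>, those of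
    \<open>r2\<close> and the \<open>r\<close> rows of \<open>W\<close> are together fewer than
    \<open>n\<close>.\<close>
  finally have "length (r1 @ r2 @ rows W) < n" using neg l1 l2 W by simp
  moreover have "set (r1 @ r2 @ rows W) \<subseteq> carrier_vec n"
    using Uc Vc W by (auto simp: r1_def r2_def rows_def intro!: carrier_vecI)
  ultimately obtain v where v: "v \<in> carrier_vec n" "v \<noteq> 0\<^sub>v n"
    and orth: "\<And>r. r \<in> set (r1 @ r2 @ rows W) \<Longrightarrow> r \<bullet> v = 0"
    using homogeneous_system_nonzero_solution by metis
  have Wv: "W *\<^sub>v v = 0\<^sub>v r"
    using W orth by (intro eq_vecI) (auto simp: rows_def)
  let ?c = "mat_adjoint U *\<^sub>v v" and ?d = "mat_adjoint V *\<^sub>v v"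
  have c0: "?c $ i = 0" if "i < n" "a i < x" for i
    using orth[of "row (mat_adjoint U) i"] that Uc by (auto simp: r1_def)
  have d0: "?d $ i = 0" if "i < n" "b i \<ge> x - w" for i
    using orth[of "row (mat_adjoint V) i"] that Vc by (auto simp: r2_def)
  let ?\<alpha> = "\<Sum>i<n. a i * (cmod (?c $ i))\<^sup>2" and ?\<beta> = "\<Sum>i<n. b i * (cmod (?d $ i))\<^sup>2"
  have "x * (vnorm2 v)\<^sup>2 \<le> ?\<alpha>"
    unfolding unitary_mat_vnorm2[OF U v(1)] sum_distrib_left
  proof (rule sum_mono)
    fix i assume "i \<in> {..<n}"
    then show "x * (cmod (?c $ i))\<^sup>2 \<le> a i * (cmod (?c $ i))\<^sup>2"
      using c0[of i] by (cases "a i < x") (auto intro: mult_right_mono)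
  qed
  moreover have "?\<beta> < (x - w) * (vnorm2 v)\<^sup>2"
  proof -
    \<comment> \<open>Strictness comes from a nonzero coordinate \<open>j\<close>: since
      \<open>d0\<close> kills all coordinates with \<open>b i \<ge> x - w\<close>, it belongs to an
      eigenvalue below \<open>x - w\<close>.\<close>
    have "(vnorm2 v)\<^sup>2 > 0" using vnorm2_pos[OF v] by simp
    then have "(\<Sum>i<n. (cmod (?d $ i))\<^sup>2) \<noteq> 0" unfolding unitary_mat_vnorm2[OF V v(1)] by simp
    then obtain j where j: "j < n" "?d $ j \<noteq> 0"
      by (metis (no_types, lifting) lessThan_iff norm_zero sum.neutral zero_power2)
    show ?thesis unfolding unitary_mat_vnorm2[OF V v(1)] sum_distrib_left
    proof (rule sum_strict_mono_ex1)
      show "\<forall>i\<in>{..<n}. b i * (cmod (?d $ i))\<^sup>2 \<le> (x - w) * (cmod (?d $ i))\<^sup>2"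
      proof
        fix i assume "i \<in> {..<n}"
        then show "b i * (cmod (?d $ i))\<^sup>2 \<le> (x - w) * (cmod (?d $ i))\<^sup>2"
          using d0[of i] by (cases "b i \<ge> x - w") (auto intro: mult_right_mono)
      qed
      show "\<exists>i\<in>{..<n}. b i * (cmod (?d $ i))\<^sup>2 < (x - w) * (cmod (?d $ i))\<^sup>2"
      proof (rule bexI[of _ j])
        have "b j < x - w" using d0[of j] j by force
        then show "b j * (cmod (?d $ j))\<^sup>2 < (x - w) * (cmod (?d $ j))\<^sup>2"
          using j by (intro mult_strict_right_mono) auto
      qed (use j in auto)
    qed simp
  qed
  moreover have "\<bar>?\<alpha> - ?\<beta>\<bar> \<le> w * (vnorm2 v)\<^sup>2"
    using cl[OF v(1) Wv] unfolding unitary_diag_form[OF U v(1)] unitary_diag_form[OF V v(1)]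
    by (simp only: norm_of_real flip: of_real_diff)
  ultimately show False by (simp add: algebra_simps)
qed

section \<open>Layer cake: from counting bounds to bounds on sums\<close>

lemma has_integral_threshold:
  fixes u :: real
  assumes "0 \<le> u" "u \<le> 1"
  shows "((\<lambda>s. if s < u then 1 else 0 :: real) has_integral u) {0..1}"
proof -
  have "((\<lambda>s. 1 :: real) has_integral u) {0..u}"
    using has_integral_const_real[of "1 :: real" 0 u] assms by simp
  then have "((\<lambda>s. if s \<in> {0..u} then 1 else 0 :: real) has_integral u) {0..1}"
    using assms by (subst has_integral_restrict) auto
  \<comment> \<open>The closed interval and the strict inequality differ only at the point
    \<open>u\<close>.\<close>
  then show ?thesis
    by (rule has_integral_spike_finite[of "{u}", rotated 2]) auto
qed

text \<open>Layer cake: \<open>u i\<close> is the integral over \<open>s \<in> [0, 1]\<close> of the indicator of \<open>s < u i\<close>.\<close>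

lemma sum_le_of_card_threshold_le:
  fixes u :: "'i \<Rightarrow> real" and v :: "'j \<Rightarrow> real"
  assumes fin: "finite I" "finite J"
    and u: "\<And>i. i \<in> I \<Longrightarrow> 0 \<le> u i \<and> u i \<le> 1" and v: "\<And>j. j \<in> J \<Longrightarrow> 0 \<le> v j \<and> v j \<le> 1"
    and card: "\<And>s. card {i\<in>I. s < u i} \<le> card {j\<in>J. s < v j} + r"
  shows "sum u I \<le> sum v J + real r"
proof -
  have 1: "((\<lambda>s. \<Sum>i\<in>I. if s < u i then 1 else 0 :: real) has_integral sum u I) {0..1}"
    using fin u by (intro has_integral_sum has_integral_threshold) auto
  have "((\<lambda>s. \<Sum>j\<in>J. if s < v j then 1 else 0 :: real) has_integral sum v J) {0..1}"
    using fin v by (intro has_integral_sum has_integral_threshold) auto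
  then have 2: "((\<lambda>s. (\<Sum>j\<in>J. if s < v j then 1 else 0 :: real) + real r) has_integral (sum v J + real r)) {0..1}"
    using has_integral_add[OF _ has_integral_const_real[of "real r" 0 1]] by fastforce
  show ?thesis
  proof (rule has_integral_le[OF 1 2])
    fix s :: real
    have "(\<Sum>i\<in>I. if s < u i then 1 else 0 :: real) = real (card {i\<in>I. s < u i})"
      "(\<Sum>j\<in>J. if s < v j then 1 else 0 :: real) = real (card {j\<in>J. s < v j})"
      using fin by (simp_all add: sum.If_cases Int_def)
    then show "(\<Sum>i\<in>I. if s < u i then 1 else 0 :: real) \<le> (\<Sum>j\<in>J. if s < v j then 1 else 0) + real r"
      using card[of s] by simp
  qed
qed

text \<open>For monotone \<open>\<phi>\<close> the set where \<open>\<phi>\<close> exceeds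
  \<open>s\<close> is closed upwards, so counting the \<open>a i\<close> in it amounts to counting
  the \<open>a i\<close> above a threshold, where \<open>card_eigenvalues_ge_le\<close> applies. The
  layer cake lemma then turns counts into sums.\<close>

lemma sum_mono_eigenvalues_le:
  fixes \<phi> :: "real \<Rightarrow> real"
  assumes U: "unitary_mat n U" and V: "unitary_mat n V"
    and close: "forms_close n r w (U * real_diag n a * mat_adjoint U) (V * real_diag n b * mat_adjoint V)"
    and mono: "mono \<phi>" and bd: "\<And>x. 0 \<le> \<phi> x" "\<And>x. \<phi> x \<le> 1"
  shows "(\<Sum>i<n. \<phi> (a i)) \<le> (\<Sum>i<n. \<phi> (b i + w)) + real r"
proof (rule sum_le_of_card_threshold_le)
  fix s
  let ?S = "{i \<in> {..<n}. s < \<phi> (a i)}"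
  show "card ?S \<le> card {j \<in> {..<n}. s < \<phi> (b j + w)} + r"
  proof (cases "?S = {}")
    case False
    \<comment> \<open>Taking the least eigenvalue in the superlevel set, instead of the infimum of
      that set, guarantees \<open>s < \<phi> x\<close>.\<close>
    define x where "x = Min (a ` ?S)"
    have "x \<in> a ` ?S" unfolding x_def using False by (intro Min_in) auto
    then have x: "s < \<phi> x" by auto
    have "card ?S \<le> card {i. i < n \<and> a i \<ge> x}"
      unfolding x_def by (intro card_mono) auto
    also have "\<dots> \<le> card {i. i < n \<and> b i \<ge> x - w} + r"
      by (rule card_eigenvalues_ge_le[OF U V close])
    also have "card {i. i < n \<and> b i \<ge> x - w} \<le> card {j \<in> {..<n}. s < \<phi> (b j + w)}"
    proof (intro card_mono subsetI)
      fix i assume "i \<in> {i. i < n \<and> b i \<ge> x - w}"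
      then show "i \<in> {j \<in> {..<n}. s < \<phi> (b j + w)}"
        using monoD[OF mono, of x "b i + w"] x by auto
    qed auto
    finally show ?thesis by simp
  qed (simp only: card.empty)
qed (use bd in auto)

text \<open>The one-sided bound is applied in both directions, using that \<open>forms_close\<close>
  is symmetric; the Lipschitz condition then removes the shift by \<open>w\<close> at a cost of
  \<open>L * w\<close> per eigenvalue.\<close>

lemma sum_lipschitz_eigenvalues:
  fixes \<phi> :: "real \<Rightarrow> real"
  assumes U: "unitary_mat n U" and V: "unitary_mat n V"
    and close: "forms_close n r w (U * real_diag n a * mat_adjoint U) (V * real_diag n b * mat_adjoint V)"
    and mono: "mono \<phi>" and bd: "\<And>x. 0 \<le> \<phi> x" "\<And>x. \<phi> x \<le> 1"
    and lip: "\<And>x. \<phi> (x + w) \<le> \<phi> x + L * w"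
  shows "\<bar>(\<Sum>i<n. \<phi> (a i)) - (\<Sum>i<n. \<phi> (b i))\<bar> \<le> real n * (L * w) + real r"
proof -
  have *: "(\<Sum>i<n. \<phi> (c i + w)) \<le> (\<Sum>i<n. \<phi> (c i)) + real n * (L * w)" for c
    using sum_mono[of "{..<n}" "\<lambda>i. \<phi> (c i + w)" "\<lambda>i. \<phi> (c i) + L * w"] lip
    by (simp add: sum.distrib)
  show ?thesis
    using *[of a] *[of b] sum_mono_eigenvalues_le[OF U V close mono bd]
      sum_mono_eigenvalues_le[OF V U forms_close_sym[OF close] mono bd] by linarith
qed

section \<open>Low rank and small norm perturbations\<close>

lemma vnorm2_smult: "vnorm2 (a \<cdot>\<^sub>v v) = cmod a * vnorm2 v"
  by (simp add: vnorm2_def norm_mult power_mult_distrib real_sqrt_mult flip: sum_distrib_left)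

lemma cmod_cscalar_prod_le:
  assumes x: "x \<in> carrier_vec n" and y: "y \<in> carrier_vec n"
  shows "cmod (x \<bullet>c y) \<le> vnorm2 x * vnorm2 y"
proof -
  have "cmod (x \<bullet>c y) \<le> (\<Sum>i<n. cmod (x $ i) * cmod (y $ i))"
    using x y by (auto simp: scalar_prod_def atLeast0LessThan norm_mult intro!: sum_norm_le)
  also have "\<dots> \<le> sqrt ((\<Sum>i<n. (cmod (x $ i))\<^sup>2) * (\<Sum>i<n. (cmod (y $ i))\<^sup>2))"
    by (rule real_le_rsqrt[OF Cauchy_Schwarz_ineq_sum])
  finally show ?thesis using x y by (simp add: vnorm2_def real_sqrt_mult)
qed

text \<open>Cauchy-Schwarz in every row. Apart from bounding the forms of symbols, this shows that
  the set in the definition of \<open>spec_norm\<close> is bounded above, so that its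
  \<open>Sup\<close> is a genuine supremum.\<close>

lemma vnorm2_mult_le_frob_norm:
  assumes N: "N \<in> carrier_mat n m" and v: "v \<in> carrier_vec m"
  shows "vnorm2 (N *\<^sub>v v) \<le> frob_norm N * vnorm2 v"
proof -
  have "(\<Sum>i<n. (cmod ((N *\<^sub>v v) $ i))\<^sup>2)
      \<le> (\<Sum>i<n. (\<Sum>j<m. (cmod (N $$ (i, j)))\<^sup>2) * (\<Sum>j<m. (cmod (v $ j))\<^sup>2))"
  proof (rule sum_mono)
    fix i assume i: "i \<in> {..<n}"
    have "cmod ((N *\<^sub>v v) $ i) \<le> (\<Sum>j<m. cmod (N $$ (i, j)) * cmod (v $ j))"
      using N v i by (auto simp: scalar_prod_def atLeast0LessThan norm_mult intro!: sum_norm_le)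
    then have "(cmod ((N *\<^sub>v v) $ i))\<^sup>2 \<le> (\<Sum>j<m. cmod (N $$ (i, j)) * cmod (v $ j))\<^sup>2"
      by (intro power_mono) auto
    also have "\<dots> \<le> (\<Sum>j<m. (cmod (N $$ (i, j)))\<^sup>2) * (\<Sum>j<m. (cmod (v $ j))\<^sup>2)"
      by (rule Cauchy_Schwarz_ineq_sum)
    finally show "(cmod ((N *\<^sub>v v) $ i))\<^sup>2 \<le> (\<Sum>j<m. (cmod (N $$ (i, j)))\<^sup>2) * (\<Sum>j<m. (cmod (v $ j))\<^sup>2)" .
  qed
  then have "sqrt (\<Sum>i<n. (cmod ((N *\<^sub>v v) $ i))\<^sup>2)
      \<le> sqrt ((\<Sum>i<n. \<Sum>j<m. (cmod (N $$ (i, j)))\<^sup>2) * (\<Sum>j<m. (cmod (v $ j))\<^sup>2))"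
    by (simp add: sum_distrib_right del: index_mult_mat_vec)
  then show ?thesis using N v by (simp add: vnorm2_def frob_norm_def real_sqrt_mult)
qed

lemma vnorm2_mult_le_spec_norm:
  assumes N: "N \<in> carrier_mat n m" and v: "v \<in> carrier_vec m"
  shows "vnorm2 (N *\<^sub>v v) \<le> spec_norm N * vnorm2 v"
proof (cases "v = 0\<^sub>v m")
  case True
  then have "N *\<^sub>v v = 0\<^sub>v n" using N by (auto intro!: eq_vecI)
  then show ?thesis using True by (simp add: vnorm2_def)
next
  case False
  then have pos: "vnorm2 v > 0" using vnorm2_pos[OF v] by simp
  define u where "u = complex_of_real (1 / vnorm2 v) \<cdot>\<^sub>v v"
  have u: "u \<in> carrier_vec m" "vnorm2 u = 1" using v pos by (auto simp: u_def vnorm2_smult norm_divide)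
  have "N *\<^sub>v u = complex_of_real (1 / vnorm2 v) \<cdot>\<^sub>v (N *\<^sub>v v)"
    unfolding u_def by (rule mult_mat_vec[OF N v])
  then have "vnorm2 (N *\<^sub>v u) = vnorm2 (N *\<^sub>v v) / vnorm2 v"
    using pos by (simp add: vnorm2_smult norm_divide)
  moreover have "vnorm2 (N *\<^sub>v u) \<le> spec_norm N"
    unfolding spec_norm_def
  proof (rule cSup_upper)
    show "vnorm2 (N *\<^sub>v u) \<in> {vnorm2 (N *\<^sub>v x) |x. x \<in> carrier_vec (dim_col N) \<and> vnorm2 x = 1}"
      using u N by auto
    show "bdd_above {vnorm2 (N *\<^sub>v x) |x. x \<in> carrier_vec (dim_col N) \<and> vnorm2 x = 1}"
      using vnorm2_mult_le_frob_norm[OF N] N by (intro bdd_aboveI[of _ "frob_norm N"]) fastforce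
  qed
  ultimately have "vnorm2 (N *\<^sub>v v) / vnorm2 v \<le> spec_norm N" by simp
  then show ?thesis using pos by (simp add: pos_divide_le_eq)
qed

text \<open>\<open>m > 0\<close> supplies a unit vector; for \<open>m = 0\<close> the supremum would
  be taken over the empty set.\<close>

lemma spec_norm_nonneg:
  assumes N: "N \<in> carrier_mat n m" and m: "m > 0"
  shows "spec_norm N \<ge> 0"
proof -
  have u: "unit_vec m 0 \<in> carrier_vec m" "unit_vec m 0 \<noteq> (0\<^sub>v m :: complex vec)"
    using m unit_vec_nonzero by auto
  then have "vnorm2 (unit_vec m 0) > 0" by (rule vnorm2_pos)
  moreover have "0 \<le> spec_norm N * vnorm2 (unit_vec m 0)"
    using vnorm2_mult_le_spec_norm[OF N u(1)] vnorm2_nonneg order_trans by blast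
  ultimately show ?thesis by (simp add: zero_le_mult_iff)
qed

text \<open>Rank factorisation: \<open>R\<close> is the matrix of a maximal independent set of its
  columns times a matrix \<open>W\<close> with \<open>mat_rank n R\<close> rows, so the equations
  \<open>W v = 0\<close> force \<open>R v = 0\<close>.\<close>

lemma mat_rank_kernel:
  assumes R: "R \<in> carrier_mat n m"
  shows "\<exists>W\<in>carrier_mat (mat_rank n R) m. \<forall>v\<in>carrier_vec m. W *\<^sub>v v = 0\<^sub>v (mat_rank n R) \<longrightarrow> R *\<^sub>v v = 0\<^sub>v n"
proof -
  interpret vec_space "TYPE(complex)" n .
  have cR: "set (cols R) \<subseteq> carrier_vec n" using R cols_dim by blast
  obtain S where fS: "finite S" and mS: "maximal S (\<lambda>T. T \<subseteq> set (cols R) \<and> lin_indpt T)"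
    using maximal_exists_superset[of "set (cols R)" "\<lambda>T. T \<subseteq> set (cols R) \<and> lin_indpt T" "{}"]
    by (auto simp: lin_dep_def)
  have rk: "mat_rank n R = card S" unfolding mat_rank_def by (rule rank_card_indpt[OF R mS])
  have S: "S \<subseteq> set (cols R)" "lin_indpt S" using mS by (auto simp: maximal_def)
  then have Sc: "S \<subseteq> carrier_vec n" using cR by blast
  have "x \<in> span S" if x: "x \<in> set (cols R)" for x
  proof (cases "x \<in> S")
    case True
    then show ?thesis using in_own_span[of S] Sc by auto
  next
    case False
    \<comment> \<open>By maximality no further column can be added to \<open>S\<close>, hence every
      column lies in its span.\<close>
    then have "lin_dep (insert x S)" using mS S x unfolding maximal_def by blast
    then show ?thesis using lin_dep_iff_in_span[of S x] S Sc cR x False by auto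
  qed
  then have "\<exists>a. x = lincomb a S" if "x \<in> set (cols R)" for x
    using finite_in_span[OF fS] Sc that by auto
  then have "\<exists>a. col R j = lincomb a S" if "j < m" for j
    using that R by (metis carrier_matD(2) cols_length cols_nth nth_mem)
  then obtain g where g: "\<And>j. j < m \<Longrightarrow> col R j = lincomb (g j) S" by metis
  obtain ss where ss: "set ss = S" "distinct ss" using finite_distinct_list[OF fS] by blast
  have len: "length ss = card S" using ss distinct_card by fastforce
  \<comment> \<open>Column \<open>j\<close> of \<open>W\<close> holds the coefficients of column
    \<open>j\<close> of \<open>R\<close> with respect to the enumeration \<open>ss\<close> of
    \<open>S\<close>.\<close>
  define W where "W = mat (card S) m (\<lambda>(k, j). g j (ss ! k))"
  have W: "W \<in> carrier_mat (card S) m" by (simp add: W_def)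
  have C: "mat_of_cols n ss \<in> carrier_mat n (card S)" using len mat_of_cols_carrier(1)[of n ss] by simp
  have "R = mat_of_cols n ss * W"
  proof (rule eq_matI)
    fix i j assume ij: "i < dim_row (mat_of_cols n ss * W)" "j < dim_col (mat_of_cols n ss * W)"
    then have i: "i < n" and j: "j < m" using C W by auto
    have "R $$ (i, j) = col R j $ i" using R i j by simp
    also have "\<dots> = (\<Sum>x\<in>S. g j x * x $ i)" unfolding g[OF j] using lincomb_index[OF i] Sc by simp
    also have "\<dots> = (\<Sum>k<card S. g j (ss ! k) * (ss ! k) $ i)"
      using sum.reindex_bij_betw[OF bij_betw_nth[OF ss(2) refl ss(1)[symmetric]], of "\<lambda>x. g j x * x $ i"] len
      by (simp add: atLeast0LessThan)
    also have "\<dots> = (mat_of_cols n ss * W) $$ (i, j)"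
      using i j C W len
      by (simp add: scalar_prod_def atLeast0LessThan W_def mat_of_cols_index mult.commute)
    finally show "R $$ (i, j) = (mat_of_cols n ss * W) $$ (i, j)" .
  qed (use R C W in auto)
  then have "R *\<^sub>v v = 0\<^sub>v n" if "v \<in> carrier_vec m" "W *\<^sub>v v = 0\<^sub>v (card S)" for v
  proof -
    have "R *\<^sub>v v = mat_of_cols n ss *\<^sub>v (W *\<^sub>v v)"
      using \<open>R = mat_of_cols n ss * W\<close> assoc_mult_mat_vec[OF C W that(1)] by simp
    then show ?thesis using that(2) C by (auto intro!: eq_vecI)
  qed
  then show ?thesis using W unfolding rk by blast
qed

text \<open>On the kernel of the equations for \<open>R\<close> only \<open>N\<close> contributes to
  the difference of the forms, and Cauchy-Schwarz bounds that contribution by the spectral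
  norm.\<close>

lemma forms_close_rank_norm:
  assumes Y: "Y \<in> carrier_mat n n" and R: "R \<in> carrier_mat n n" and N: "N \<in> carrier_mat n n"
  shows "forms_close n (mat_rank n R) (spec_norm N) (Y + R + N) Y"
proof -
  obtain W where W: "W \<in> carrier_mat (mat_rank n R) n"
    and ker: "\<And>v. v \<in> carrier_vec n \<Longrightarrow> W *\<^sub>v v = 0\<^sub>v (mat_rank n R) \<Longrightarrow> R *\<^sub>v v = 0\<^sub>v n"
    using mat_rank_kernel[OF R] by blast
  have "cmod (((Y + R + N) *\<^sub>v v) \<bullet>c v - (Y *\<^sub>v v) \<bullet>c v) \<le> spec_norm N * (vnorm2 v)\<^sup>2"
    if v: "v \<in> carrier_vec n" "W *\<^sub>v v = 0\<^sub>v (mat_rank n R)" for v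
  proof -
    have c: "Y *\<^sub>v v \<in> carrier_vec n" "N *\<^sub>v v \<in> carrier_vec n" using Y N v by auto
    have "(Y + R + N) *\<^sub>v v = Y *\<^sub>v v + R *\<^sub>v v + N *\<^sub>v v"
      using Y R N v add_mult_distrib_mat_vec[of "Y + R" n n N v] add_mult_distrib_mat_vec[of Y n n R v]
      by simp
    also have "\<dots> = Y *\<^sub>v v + N *\<^sub>v v" using ker[OF v] c by simp
    finally have "((Y + R + N) *\<^sub>v v) \<bullet>c v - (Y *\<^sub>v v) \<bullet>c v = (N *\<^sub>v v) \<bullet>c v"
      using c v by (simp add: add_scalar_prod_distrib[of _ n])
    then have "cmod (((Y + R + N) *\<^sub>v v) \<bullet>c v - (Y *\<^sub>v v) \<bullet>c v) \<le> vnorm2 (N *\<^sub>v v) * vnorm2 v"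
      using cmod_cscalar_prod_le[OF c(2) v(1)] by simp
    also have "\<dots> \<le> (spec_norm N * vnorm2 v) * vnorm2 v"
      by (intro mult_right_mono vnorm2_mult_le_spec_norm[OF N v(1)]) simp
    finally show ?thesis by (simp add: power2_eq_square mult.assoc)
  qed
  then show ?thesis using W by (auto simp: forms_close_def)
qed

text \<open>The version for symbols, with no linear equations at all. The Frobenius norm appears
  because convergence in measure of the symbols is expressed by it.\<close>

lemma forms_close_frob_norm:
  assumes X: "X \<in> carrier_mat n n" and Y: "Y \<in> carrier_mat n n"
  shows "forms_close n 0 (frob_norm (X - Y)) X Y"
proof -
  have "cmod ((X *\<^sub>v v) \<bullet>c v - (Y *\<^sub>v v) \<bullet>c v) \<le> frob_norm (X - Y) * (vnorm2 v)\<^sup>2"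
    if v: "v \<in> carrier_vec n" for v
  proof -
    have c: "X *\<^sub>v v \<in> carrier_vec n" "Y *\<^sub>v v \<in> carrier_vec n" "(X - Y) *\<^sub>v v \<in> carrier_vec n"
      using X Y v by (auto intro!: mult_mat_vec_carrier[of _ n n])
    have "(X *\<^sub>v v) \<bullet>c v - (Y *\<^sub>v v) \<bullet>c v = ((X - Y) *\<^sub>v v) \<bullet>c v"
      using X Y v c by (simp add: minus_mult_distrib_mat_vec[of _ n n] minus_scalar_prod_distrib[of _ n])
    then have "cmod ((X *\<^sub>v v) \<bullet>c v - (Y *\<^sub>v v) \<bullet>c v) \<le> vnorm2 ((X - Y) *\<^sub>v v) * vnorm2 v"
      using cmod_cscalar_prod_le[OF c(3) v] by simp
    also have "\<dots> \<le> (frob_norm (X - Y) * vnorm2 v) * vnorm2 v"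
      using X Y v by (intro mult_right_mono vnorm2_mult_le_frob_norm[of _ n n]) auto
    finally show ?thesis by (simp add: power2_eq_square mult.assoc)
  qed
  then show ?thesis by (auto simp: forms_close_def intro!: bexI[of _ "0\<^sub>m 0 n"])
qed

section \<open>Eigenvalue sums of continuous functions with compact support\<close>

text \<open>A scaled and translated copy of this function with \<open>h > 0\<close> is monotone, has
  values in [0, 1] and Lipschitz constant \<open>1 / h\<close>, as
  \<open>sum_lipschitz_eigenvalues\<close> requires.\<close>

definition ramp :: "real \<Rightarrow> real" where
  "ramp x = max 0 (min 1 x)"

lemma ramp_bounds: "0 \<le> ramp x" "ramp x \<le> 1"
  by (auto simp: ramp_def)

lemma ramp_eq_0: "x \<le> 0 \<Longrightarrow> ramp x = 0"
  by (auto simp: ramp_def)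

lemma ramp_eq_1: "1 \<le> x \<Longrightarrow> ramp x = 1"
  by (auto simp: ramp_def)

lemma ramp_mono: "x \<le> y \<Longrightarrow> ramp x \<le> ramp y"
  by (auto simp: ramp_def)

lemma ramp_add_le: "0 \<le> w \<Longrightarrow> ramp (x + w) \<le> ramp x + w"
  by (auto simp: ramp_def)

lemma Cc_continuous: "F \<in> Cc \<Longrightarrow> continuous_on UNIV F"
  by (simp add: Cc_def)

lemma Cc_support:
  assumes "F \<in> Cc"
  obtains M where "M > 0" "\<And>x. \<bar>x\<bar> \<ge> M \<Longrightarrow> F x = 0"
proof -
  have "bounded (closure {x. F x \<noteq> 0})" using assms by (auto simp: Cc_def compact_imp_bounded)
  then obtain B where "B > 0" and B: "\<And>x. x \<in> closure {x. F x \<noteq> 0} \<Longrightarrow> norm x \<le> B"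
    using bounded_pos by metis
  have "F x = 0" if "\<bar>x\<bar> \<ge> B + 1" for x
    using B[of x] closure_subset[of "{x. F x \<noteq> 0}"] that by fastforce
  then show ?thesis using that[of "B + 1"] \<open>B > 0\<close> by auto
qed

lemma Cc_bounded:
  assumes "F \<in> Cc"
  obtains K where "K \<ge> 0" "\<And>x. norm (F x) \<le> K"
proof -
  obtain M where M: "M > 0" "\<And>x. \<bar>x\<bar> \<ge> M \<Longrightarrow> F x = 0" using Cc_support[OF assms] by blast
  have "compact (F ` {-M..M})"
    using Cc_continuous[OF assms] by (intro compact_continuous_image) (auto intro: continuous_on_subset)
  then obtain K where K: "K > 0" "\<And>x. x \<in> {-M..M} \<Longrightarrow> norm (F x) \<le> K"
    using compact_imp_bounded bounded_pos by (metis image_eqI)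
  have "norm (F x) \<le> K" for x
  proof (cases "x \<in> {-M..M}")
    case False
    then have "\<bar>x\<bar> \<ge> M" by auto
    then show ?thesis using M(2)[of x] K(1) by simp
  qed (rule K(2))
  then show ?thesis using that[of K] K by auto
qed

text \<open>The sum of ramps is the piecewise linear interpolant of \<open>F\<close> on a grid of
  mesh \<open>h\<close> in [-M, M]: each ramp climbs across one cell, with the increment of
  \<open>F\<close> over that cell as coefficient. Uniform continuity controls the error, and
  \<open>F\<close> vanishes at both ends of the grid.\<close>

lemma Cc_ramp_approx:
  assumes F: "F \<in> Cc" and \<epsilon>: "\<epsilon> > 0"
  shows "\<exists>h (K :: nat) c y. h > 0 \<and>
    (\<forall>x. norm (F x - (\<Sum>k<K. c k * complex_of_real (ramp ((x - y k) / h)))) \<le> \<epsilon>)"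
proof -
  obtain M where M: "M > 0" "\<And>x. \<bar>x\<bar> \<ge> M \<Longrightarrow> F x = 0" using Cc_support[OF F] by blast
  have "uniformly_continuous_on {-M..M} F"
    using Cc_continuous[OF F] by (intro compact_uniformly_continuous) (auto intro: continuous_on_subset)
  then obtain \<delta> where \<delta>: "\<delta> > 0"
    "\<And>x x'. x \<in> {-M..M} \<Longrightarrow> x' \<in> {-M..M} \<Longrightarrow> dist x' x < \<delta> \<Longrightarrow> dist (F x') (F x) < \<epsilon> / 2"
    unfolding uniformly_continuous_on_def using \<epsilon> half_gt_zero by metis
  \<comment> \<open>Enough cells for the mesh \<open>h = 2 * M / K\<close> to be below
    \<open>\<delta>\<close>.\<close>
  obtain K :: nat where K: "K > 2 * M / \<delta>" using reals_Archimedean2 by blast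
  have K0: "real K > 0" using K M(1) \<delta>(1) by (meson divide_pos_pos less_trans mult_pos_pos zero_less_numeral)
  define h where "h = 2 * M / K"
  have h: "h > 0" "h < \<delta>" using K K0 M(1) \<delta>(1) by (auto simp: h_def field_simps)
  define y where "y k = - M + real k * h" for k
  have y0: "y 0 = - M" and yK: "y K = M" using K0 by (simp_all add: y_def h_def)
  have ySuc: "y (Suc k) = y k + h" for k by (simp add: y_def algebra_simps)
  have ymono: "y i \<le> y j" if "i \<le> j" for i j using that h(1) by (simp add: y_def)
  define c where "c k = F (y (Suc k)) - F (y k)" for k
  let ?G = "\<lambda>x. \<Sum>k<K. c k * complex_of_real (ramp ((x - y k) / h))"
  \<comment> \<open>Ramps whose cell lies to the left of \<open>x\<close> have reached 1, so their
    coefficients telescope.\<close>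
  have low: "(\<Sum>k<m. c k * complex_of_real (ramp ((x - y k) / h))) = F (y m) - F (y 0)" if "y m \<le> x" for m x
  proof -
    have "(\<Sum>k<m. c k * complex_of_real (ramp ((x - y k) / h))) = (\<Sum>k<m. c k)"
    proof (rule sum.cong)
      fix k assume "k \<in> {..<m}"
      then have "y k + h \<le> x" using ymono[of "Suc k" m] that ySuc[of k] by auto
      then have "ramp ((x - y k) / h) = 1" using h(1) by (intro ramp_eq_1) (simp add: field_simps)
      then show "c k * complex_of_real (ramp ((x - y k) / h)) = c k" by simp
    qed simp
    also have "\<dots> = F (y m) - F (y 0)" unfolding c_def by (rule sum_lessThan_telescope)
    finally show ?thesis .
  qed
  have "norm (F x - ?G x) \<le> \<epsilon>" for x
  proof -
    consider "x \<le> - M" | "M \<le> x" | "- M < x" "x < M" by linarith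
    then show ?thesis
    proof cases
      case 1
      have "ramp ((x - y k) / h) = 0" for k
        using 1 y0 ymono[of 0 k] h(1) by (intro ramp_eq_0) (simp add: divide_le_0_iff)
      then show ?thesis using M(2)[of x] 1 \<epsilon> by simp
    next
      case 2
      then show ?thesis using low[of K x] yK y0 M(1) M(2)[of x] M(2)[of M] M(2)[of "- M"] \<epsilon> by simp
    next
      case 3
      \<comment> \<open>\<open>m\<close> is the number of the cell that contains \<open>x\<close>.
        Ramps before it are saturated, ramps after it are still 0, and only ramp \<open>m\<close>
        can take an intermediate value.\<close>
      define m where "m = nat \<lfloor>(x + M) / h\<rfloor>"
      have m: "real m = of_int \<lfloor>(x + M) / h\<rfloor>" using 3 h(1) by (simp add: m_def)
      have "real m \<le> (x + M) / h" "(x + M) / h < real m + 1" unfolding m by linarith+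
      then have ym: "y m \<le> x" "x < y (Suc m)" using h(1) by (auto simp: y_def field_simps)
      have mK: "m < K" using ym(1) 3(2) yK ymono[of K m] by (cases "m < K") auto
      have "?G x = (\<Sum>k<Suc m. c k * complex_of_real (ramp ((x - y k) / h)))"
      proof (rule sum.mono_neutral_right)
        show "\<forall>k\<in>{..<K} - {..<Suc m}. c k * complex_of_real (ramp ((x - y k) / h)) = 0"
        proof
          fix k assume "k \<in> {..<K} - {..<Suc m}"
          then have "x \<le> y k" using ymono[of "Suc m" k] ym(2) by auto
          then have "ramp ((x - y k) / h) = 0"
            using h(1) by (intro ramp_eq_0) (simp add: divide_le_0_iff)
          then show "c k * complex_of_real (ramp ((x - y k) / h)) = 0" by simp
        qed
      qed (use mK in auto)
      also have "\<dots> = F (y m) - F (y 0) + c m * complex_of_real (ramp ((x - y m) / h))"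
        using low[OF ym(1)] by simp
      also have "F (y 0) = 0" unfolding y0 using M(1) M(2)[of "- M"] by simp
      finally have G: "F x - ?G x = (F x - F (y m)) - c m * complex_of_real (ramp ((x - y m) / h))" by simp
      have in1: "y m \<in> {-M..M}" "y (Suc m) \<in> {-M..M}"
        using ymono[of 0 m] ymono[of m K] ymono[of 0 "Suc m"] ymono[of "Suc m" K] mK y0 yK by auto
      have "norm (F x - F (y m)) \<le> \<epsilon> / 2"
        using \<delta>(2)[of "y m" x] in1 3 ym ySuc[of m] h by (auto simp: dist_norm)
      moreover have "norm (c m) \<le> \<epsilon> / 2"
        using \<delta>(2)[of "y m" "y (Suc m)"] in1 ySuc[of m] h by (auto simp: dist_norm c_def)
      then have "norm (c m * complex_of_real (ramp ((x - y m) / h))) \<le> \<epsilon> / 2"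
        using mult_mono[of "norm (c m)" "\<epsilon> / 2" "ramp ((x - y m) / h)" 1] ramp_bounds[of "(x - y m) / h"] \<epsilon>
        by (simp add: norm_mult)
      ultimately show ?thesis unfolding G
        using norm_triangle_ineq4[of "F x - F (y m)" "c m * complex_of_real (ramp ((x - y m) / h))"] by linarith
    qed
  qed
  then show ?thesis using h(1) by blast
qed

lemma hermitian_eig_sum_obtain:
  assumes "hermitian_mat n X"
  obtains U a where "unitary_mat n U" "X = U * real_diag n a * mat_adjoint U"
    "\<And>F. eig_sum F X = (\<Sum>i<n. F (a i))"
  using spectral_theorem[OF assms] eig_sum_unitary_diag by metis

lemma eig_sum_perturb:
  assumes F: "F \<in> Cc" and \<epsilon>: "\<epsilon> > 0"
  obtains C where "C \<ge> 0"
    "\<And>n X Y r w. \<lbrakk>hermitian_mat n X; hermitian_mat n Y; forms_close n r w X Y; 0 \<le> w\<rbrakk>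
      \<Longrightarrow> norm (eig_sum F X - eig_sum F Y) \<le> \<epsilon> * real n + C * (w * real n + real r)"
proof -
  obtain h y c and K :: nat where h: "h > 0" and
    app: "\<And>x. norm (F x - (\<Sum>k<K. c k * complex_of_real (ramp ((x - y k) / h)))) \<le> \<epsilon> / 2"
    using Cc_ramp_approx[OF F half_gt_zero[OF \<epsilon>]] by blast
  define G where "G x = (\<Sum>k<K. c k * complex_of_real (ramp ((x - y k) / h)))" for x
  \<comment> \<open>A ramp of slope \<open>1 / h\<close> contributes at most
    \<open>(1 / h) * (w * n) + r\<close>; the maximum with 1 covers both terms by one factor.
    \<open>C\<close> depends on \<open>F\<close> and \<open>\<epsilon>\<close> only, through the
    approximation.\<close>
  define C where "C = (\<Sum>k<K. norm (c k)) * max 1 (1 / h)"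
  show ?thesis
  proof (rule that[of C])
    show "C \<ge> 0" by (auto simp: C_def sum_nonneg)
    fix n X Y r and w :: real
    assume X: "hermitian_mat n X" and Y: "hermitian_mat n Y" and close: "forms_close n r w X Y" and w: "0 \<le> w"
    obtain U a where U: "unitary_mat n U" and Xe: "X = U * real_diag n a * mat_adjoint U"
      and eX: "\<And>F. eig_sum F X = (\<Sum>i<n. F (a i))" using hermitian_eig_sum_obtain[OF X] by metis
    obtain V b where V: "unitary_mat n V" and Ye: "Y = V * real_diag n b * mat_adjoint V"
      and eY: "\<And>F. eig_sum F Y = (\<Sum>i<n. F (b i))" using hermitian_eig_sum_obtain[OF Y] by metis
    have FG: "norm ((\<Sum>i<n. F (a i)) - (\<Sum>i<n. G (a i))) \<le> \<epsilon> / 2 * real n" for a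
      unfolding sum_subtractf[symmetric] using app sum_norm_le[of "{..<n}" "\<lambda>i. F (a i) - G (a i)" "\<lambda>_. \<epsilon> / 2"]
      by (simp add: G_def mult.commute)
    have ramp: "\<bar>(\<Sum>i<n. ramp ((a i - z) / h)) - (\<Sum>i<n. ramp ((b i - z) / h))\<bar>
        \<le> max 1 (1 / h) * (w * real n + real r)" for z
    proof -
      have "\<bar>(\<Sum>i<n. ramp ((a i - z) / h)) - (\<Sum>i<n. ramp ((b i - z) / h))\<bar>
          \<le> real n * (1 / h * w) + real r"
      proof (rule sum_lipschitz_eigenvalues[OF U V close[unfolded Xe Ye]])
        show "mono (\<lambda>x. ramp ((x - z) / h))"
          using h by (intro monoI ramp_mono divide_right_mono) auto
        show "ramp ((x + w - z) / h) \<le> ramp ((x - z) / h) + 1 / h * w" for x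
          using ramp_add_le[of "w / h" "(x - z) / h"] w h by (simp add: add_divide_distrib[symmetric] algebra_simps)
      qed (simp_all add: ramp_bounds)
      also have "\<dots> = 1 / h * (w * real n) + 1 * real r" by simp
      also have "\<dots> \<le> max 1 (1 / h) * (w * real n) + max 1 (1 / h) * real r"
        using w by (intro add_mono mult_right_mono) auto
      finally show ?thesis by (simp add: algebra_simps)
    qed
    have "(\<Sum>i<n. G (a i)) - (\<Sum>i<n. G (b i))
        = (\<Sum>k<K. c k * complex_of_real ((\<Sum>i<n. ramp ((a i - y k) / h)) - (\<Sum>i<n. ramp ((b i - y k) / h))))"
      unfolding G_def
      by (subst (1 2) sum.swap) (simp add: sum_distrib_left right_diff_distrib sum_subtractf)
    also have "norm \<dots> \<le> (\<Sum>k<K. norm (c k) * (max 1 (1 / h) * (w * real n + real r)))"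
    proof (rule sum_norm_le)
      fix k
      show "norm (c k * complex_of_real ((\<Sum>i<n. ramp ((a i - y k) / h)) - (\<Sum>i<n. ramp ((b i - y k) / h))))
        \<le> norm (c k) * (max 1 (1 / h) * (w * real n + real r))"
        unfolding norm_mult norm_of_real by (intro mult_left_mono ramp) simp
    qed
    also have "\<dots> = C * (w * real n + real r)"
      by (simp add: C_def sum_distrib_right mult.assoc)
    finally have "norm ((\<Sum>i<n. G (a i)) - (\<Sum>i<n. G (b i))) \<le> C * (w * real n + real r)" .
    \<comment> \<open>Replacing \<open>F\<close> by \<open>G\<close> costs
      \<open>\<epsilon> / 2 * n\<close> once for \<open>X\<close> and once for
      \<open>Y\<close>.\<close>
    moreover have "eig_sum F X - eig_sum F Y = ((\<Sum>i<n. F (a i)) - (\<Sum>i<n. G (a i)))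
        + (((\<Sum>i<n. G (a i)) - (\<Sum>i<n. G (b i))) - ((\<Sum>i<n. F (b i)) - (\<Sum>i<n. G (b i))))"
      by (simp add: eX eY)
    ultimately show "norm (eig_sum F X - eig_sum F Y) \<le> \<epsilon> * real n + C * (w * real n + real r)"
      using FG[of a] FG[of b] norm_triangle_ineq[of "(\<Sum>i<n. F (a i)) - (\<Sum>i<n. G (a i))"
        "((\<Sum>i<n. G (a i)) - (\<Sum>i<n. G (b i))) - ((\<Sum>i<n. F (b i)) - (\<Sum>i<n. G (b i)))"]
        norm_triangle_ineq4[of "(\<Sum>i<n. G (a i)) - (\<Sum>i<n. G (b i))" "(\<Sum>i<n. F (b i)) - (\<Sum>i<n. G (b i))"]
      by simp
  qed
qed

lemma norm_eig_sum_le: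
  assumes "hermitian_mat n X" and K: "\<And>x. norm (F x) \<le> K"
  shows "norm (eig_sum F X) \<le> K * real n"
proof -
  obtain a where "eig_sum F X = (\<Sum>i<n. F (a i))" using hermitian_eig_sum_obtain[OF assms(1)] by metis
  then show ?thesis using sum_norm_le[of "{..<n}" "\<lambda>i. F (a i)" "\<lambda>_. K"] K by (simp add: mult.commute)
qed

lemma hermitian_mat_unitary_diag:
  assumes U: "unitary_mat n U"
  shows "hermitian_mat n (U * real_diag n a * mat_adjoint U)"
proof -
  have "hermitian_mat n (real_diag n a)"
    by (auto simp: hermitian_mat_def real_diag_def intro!: eq_matI)
  moreover have "mat_adjoint U \<in> carrier_mat n n" using U by (simp add: unitary_mat_def)
  ultimately show ?thesis using hermitian_mat_conj[of n "real_diag n a" "mat_adjoint U" n] by simp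
qed

text \<open>Extending a diagonalisation of \<open>B\<close> by an identity block diagonalises the
  padded matrix, whose eigenvalues are those of \<open>B\<close> and \<open>n - m\<close> zeros. The
  latter account for the term with \<open>F 0\<close>.\<close>

lemma pad_zero_unitary_diag:
  assumes B: "hermitian_mat m B" and le: "m \<le> n" and U: "unitary_mat n U"
  shows "hermitian_mat n (U * pad_zero n B * mat_adjoint U)"
    and "eig_sum F (U * pad_zero n B * mat_adjoint U) = eig_sum F B + of_nat (n - m) * F 0"
proof -
  obtain V b where V: "unitary_mat m V" and Be: "B = V * real_diag m b * mat_adjoint V"
    and eB: "\<And>F. eig_sum F B = (\<Sum>i<m. F (b i))" using hermitian_eig_sum_obtain[OF B] by metis
  define k where "k = n - m"
  have n: "n = m + k" using le by (simp add: k_def)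
  have one: "unitary_mat k (1\<^sub>m k)" by (simp add: unitary_mat_def)
  have c: "V \<in> carrier_mat m m" "U \<in> carrier_mat n n" using V U by (auto simp: unitary_mat_def)
  define W where "W = four_block_mat V (0\<^sub>m m k) (0\<^sub>m k m) (1\<^sub>m k)"
  have W: "unitary_mat n W" and Wa: "mat_adjoint W = four_block_mat (mat_adjoint V) (0\<^sub>m m k) (0\<^sub>m k m) (1\<^sub>m k)"
    using unitary_mat_four_block[OF V one] by (simp_all add: W_def n)
  have Wc: "W \<in> carrier_mat n n" using W by (simp add: unitary_mat_def)
  have dimB: "dim_row B = m" using B by (auto simp: hermitian_mat_def)
  define e where "e i = (if i < m then b i else 0)" for i
  have z: "0\<^sub>m k k = real_diag k (\<lambda>_. 0)" by (rule eq_matI) (auto simp: real_diag_def)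
  have "pad_zero n B = four_block_mat B (0\<^sub>m m k) (0\<^sub>m k m) (real_diag k (\<lambda>_. 0))"
    unfolding pad_zero_def dimB k_def[symmetric] z ..
  also have "\<dots> = W * four_block_mat (real_diag m b) (0\<^sub>m m k) (0\<^sub>m k m) (real_diag k (\<lambda>_. 0)) * mat_adjoint W"
    unfolding Wa unfolding W_def Be using c by (simp add: mult_block_diag mult_carrier_mat[of _ m m _ m])
  also have "four_block_mat (real_diag m b) (0\<^sub>m m k) (0\<^sub>m k m) (real_diag k (\<lambda>_. 0)) = real_diag n e"
    unfolding four_block_real_diag n e_def ..
  finally have "U * pad_zero n B * mat_adjoint U = (U * W) * real_diag n e * mat_adjoint (U * W)"
    using c Wc by (simp add: assoc_mult_mat[of _ n n _ n _ n] mult_carrier_mat[of _ n n _ n]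
        mat_adjoint_mult[of _ n n _ n])
  note eq = this and UW = unitary_mat_mult[OF U W]
  show "hermitian_mat n (U * pad_zero n B * mat_adjoint U)"
    unfolding eq by (rule hermitian_mat_unitary_diag[OF UW])
  have "eig_sum F (U * pad_zero n B * mat_adjoint U) = (\<Sum>i<n. F (e i))"
    unfolding eq by (rule eig_sum_unitary_diag[OF UW])
  also have "(\<Sum>i<m + l. F (e i)) = (\<Sum>i<m. F (b i)) + of_nat l * F 0" for l
    by (induction l) (auto simp: e_def algebra_simps)
  then have "(\<Sum>i<n. F (e i)) = (\<Sum>i<m. F (b i)) + of_nat k * F 0" unfolding n .
  finally show "eig_sum F (U * pad_zero n B * mat_adjoint U) = eig_sum F B + of_nat (n - m) * F 0"
    by (simp add: eB k_def)
qed

section \<open>Convergence of symbols and of eigenvalue distributions\<close>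

lemma frob_norm_minus:
  assumes "X \<in> carrier_mat p p" "Y \<in> carrier_mat p p"
  shows "frob_norm (X - Y) = sqrt (\<Sum>i<p. \<Sum>j<p. (cmod (X $$ (i, j) - Y $$ (i, j)))\<^sup>2)"
  using assms by (auto simp: frob_norm_def intro!: sum.cong)

lemma cmod_index_le_frob_norm:
  assumes X: "X \<in> carrier_mat n m" and "i < n" "j < m"
  shows "cmod (X $$ (i, j)) \<le> frob_norm X"
proof -
  have "(cmod (X $$ (i, j)))\<^sup>2 \<le> (\<Sum>j<m. (cmod (X $$ (i, j)))\<^sup>2)"
    using assms by (intro member_le_sum) auto
  also have "\<dots> \<le> (\<Sum>i<n. \<Sum>j<m. (cmod (X $$ (i, j)))\<^sup>2)"
    using assms by (intro member_le_sum[of i _ "\<lambda>i. \<Sum>j<m. (cmod (X $$ (i, j)))\<^sup>2"]) (auto intro: sum_nonneg)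
  finally show ?thesis using X by (auto simp: frob_norm_def intro!: real_le_rsqrt)
qed

lemma frob_norm_nonneg: "frob_norm X \<ge> 0"
  by (simp add: frob_norm_def sum_nonneg)

lemma hermitian_matI:
  assumes "A \<in> carrier_mat n n" "\<And>i j. i < n \<Longrightarrow> j < n \<Longrightarrow> A $$ (i, j) = cnj (A $$ (j, i))"
  shows "hermitian_mat n A"
  using assms(1) unfolding hermitian_mat_def
  by (auto intro!: eq_matI assms(2)[symmetric])

lemma hermitian_mat_zero: "hermitian_mat n (0\<^sub>m n n)"
  by (rule hermitian_matI) auto

text \<open>Functions \<open>g\<close> on index pairs stand in for matrices, because the type of matrices carries no
  topology.\<close>

lemma continuous_on_eig_sum:
  assumes F: "F \<in> Cc"
  shows "continuous_on {g. hermitian_mat p (mat p p g)} (\<lambda>g. eig_sum F (mat p p g))"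
  unfolding continuous_on_def
proof (intro ballI tendstoI)
  let ?H = "{g. hermitian_mat p (mat p p g)}"
  fix g and e :: real
  assume g: "g \<in> ?H" and e: "e > 0"
  \<comment> \<open>The summand 1 keeps the denominator positive for \<open>p = 0\<close>; in all
    cases \<open>\<epsilon> * p < e\<close>.\<close>
  define \<epsilon> where "\<epsilon> = e / (2 * real p + 1)"
  have \<epsilon>: "\<epsilon> > 0" using e by (simp add: \<epsilon>_def)
  have \<epsilon>p: "\<epsilon> * real p < e" using e by (simp add: \<epsilon>_def field_simps add_pos_nonneg)
  obtain C where "C \<ge> 0" and C: "\<And>n X Y r w. \<lbrakk>hermitian_mat n X; hermitian_mat n Y; forms_close n r w X Y; 0 \<le> w\<rbrakk>
      \<Longrightarrow> norm (eig_sum F X - eig_sum F Y) \<le> \<epsilon> * real n + C * (w * real n + real r)"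
    using eig_sum_perturb[OF F \<epsilon>] by blast
  have coord: "((\<lambda>x. x ij) \<longlongrightarrow> g ij) (at g within ?H)" for ij :: "nat \<times> nat"
  proof -
    have "continuous_on UNIV (\<lambda>x :: nat \<times> nat \<Rightarrow> complex. x ij)"
      by (rule continuous_on_product_coordinates)
    then have "((\<lambda>x. x ij) \<longlongrightarrow> g ij) (at g within UNIV)" by (simp add: continuous_on_def)
    then show ?thesis by (rule tendsto_within_subset) simp
  qed
  \<comment> \<open>Convergence in the function space is coordinatewise, and the Frobenius distance
    is a continuous function of finitely many coordinates, so the perturbation bound tends to
    \<open>\<epsilon> * p\<close>.\<close>
  have "((\<lambda>x. \<epsilon> * real p + C * (sqrt (\<Sum>i<p. \<Sum>j<p. (cmod (x (i, j) - g (i, j)))\<^sup>2) * real p)) \<longlongrightarrow>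
      \<epsilon> * real p + C * (sqrt (\<Sum>i<p. \<Sum>j<p. (cmod (g (i, j) - g (i, j)))\<^sup>2) * real p)) (at g within ?H)"
    by (intro tendsto_intros coord)
  then have "((\<lambda>x. \<epsilon> * real p + C * (frob_norm (mat p p x - mat p p g) * real p)) \<longlongrightarrow> \<epsilon> * real p) (at g within ?H)"
    by (simp add: frob_norm_minus[of _ p])
  then have "\<forall>\<^sub>F x in at g within ?H. \<epsilon> * real p + C * (frob_norm (mat p p x - mat p p g) * real p) < e"
    using \<epsilon>p by (rule order_tendstoD(2))
  moreover have "\<forall>\<^sub>F x in at g within ?H. x \<in> ?H"
    by (simp add: eventually_at_filter)
  ultimately show "\<forall>\<^sub>F x in at g within ?H. dist (eig_sum F (mat p p x)) (eig_sum F (mat p p g)) < e"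
  proof eventually_elim
    case (elim x)
    have "forms_close p 0 (frob_norm (mat p p x - mat p p g)) (mat p p x) (mat p p g)"
      by (rule forms_close_frob_norm) auto
    then have "norm (eig_sum F (mat p p x) - eig_sum F (mat p p g))
        \<le> \<epsilon> * real p + C * (frob_norm (mat p p x - mat p p g) * real p + real 0)"
      using C elim(2) g frob_norm_nonneg by blast
    then show ?case using elim(1) by (simp add: dist_norm)
  qed
qed

lemma borel_measurable_eig_sum:
  assumes F: "F \<in> Cc" and f: "mat_measurable_on p S f" and herm: "\<And>s. s \<in> S \<Longrightarrow> hermitian_mat p (f s)"
  shows "(\<lambda>s. eig_sum F (f s)) \<in> borel_measurable (restrict_space lebesgue S)"
proof -
  let ?M = "restrict_space lebesgue S" and ?H = "{g. hermitian_mat p (mat p p g)}"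
  \<comment> \<open>Setting \<open>g\<close> to 0 outside the index range makes every coordinate
    measurable, so that measurability into the product space can be checked coordinatewise.\<close>
  define g where "g s = (\<lambda>(i, j). if i < p \<and> j < p then f s $$ (i, j) else 0)" for s
  have fg: "mat p p (g s) = f s" if "s \<in> S" for s
    using f that by (intro eq_matI) (auto simp: g_def mat_measurable_on_def)
  have "(\<lambda>s. g s ij) \<in> borel_measurable ?M" for ij
  proof (cases ij)
    case (Pair i j)
    have "(\<lambda>s. f s $$ (i, j)) \<in> borel_measurable ?M" if "i < p" "j < p"
      using f that by (auto simp: mat_measurable_on_def)
    then show ?thesis unfolding Pair g_def by (cases "i < p \<and> j < p") auto
  qed
  then have "g \<in> borel_measurable ?M" by (rule measurable_coordinatewise_then_product)
  then have "g \<in> measurable ?M (restrict_space borel ?H)"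
    using fg herm by (intro measurable_restrict_space2) (auto simp: space_restrict_space)
  from measurable_compose[OF this borel_measurable_continuous_on_restrict[OF continuous_on_eig_sum[OF F]]]
  have "(\<lambda>s. eig_sum F (mat p p (g s))) \<in> borel_measurable ?M" .
  then show ?thesis
    by (subst measurable_cong[where g = "\<lambda>s. eig_sum F (mat p p (g s))"])
      (auto simp: fg space_restrict_space)
qed

section \<open>Measurability of symbols and exceptional null sets\<close>

lemma mat_measurable_on_extend_zero:
  assumes S: "S \<in> sets lebesgue" and D: "D \<in> sets lebesgue" and SD: "S \<subseteq> D"
    and g: "mat_measurable_on p S g"
  shows "mat_measurable_on p D (\<lambda>s. if s \<in> S then g s else 0\<^sub>m p p)"
  unfolding mat_measurable_on_def
proof (intro conjI ballI allI impI)
  fix s show "(if s \<in> S then g s else 0\<^sub>m p p) \<in> carrier_mat p p"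
    using g by (auto simp: mat_measurable_on_def)
next
  fix i j assume ij: "i < p" "j < p"
  have "(\<lambda>x. indicator S x *\<^sub>R g x $$ (i, j)) \<in> borel_measurable lebesgue"
    using g ij S by (subst borel_measurable_restrict_space_iff[symmetric]) (auto simp: mat_measurable_on_def)
  also have "(\<lambda>x. indicator S x *\<^sub>R g x $$ (i, j))
      = (\<lambda>x. indicator D x *\<^sub>R (if x \<in> S then g x else 0\<^sub>m p p) $$ (i, j))"
    using SD ij by (auto simp: fun_eq_iff indicator_def)
  finally show "(\<lambda>s. (if s \<in> S then g s else 0\<^sub>m p p) $$ (i, j)) \<in> borel_measurable (restrict_space lebesgue D)"
    using D by (subst borel_measurable_restrict_space_iff) auto
qed

lemma sets_frob_norm_greater:
  assumes D: "D \<in> sets lebesgue" and f: "mat_measurable_on p D f" and g: "mat_measurable_on p D g"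
  shows "{s \<in> D. frob_norm (f s - g s) > \<epsilon>} \<in> sets lebesgue"
proof -
  let ?M = "restrict_space lebesgue D"
  let ?h = "\<lambda>s. sqrt (\<Sum>i<p. \<Sum>j<p. (cmod (f s $$ (i, j) - g s $$ (i, j)))\<^sup>2)"
  have "(\<lambda>s. (cmod (f s $$ (i, j) - g s $$ (i, j)))\<^sup>2) \<in> borel_measurable ?M" if "i < p" "j < p" for i j
  proof -
    have [measurable]: "(\<lambda>s. f s $$ (i, j)) \<in> borel_measurable ?M" "(\<lambda>s. g s $$ (i, j)) \<in> borel_measurable ?M"
      using f g that by (auto simp: mat_measurable_on_def)
    show ?thesis by measurable
  qed
  then have "?h \<in> borel_measurable ?M"
    by (intro measurable_compose[OF _ borel_measurable_sqrt] borel_measurable_sum) auto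
  then have "{s \<in> space ?M. ?h s > \<epsilon>} \<in> sets ?M" by (rule borel_measurable_less[OF borel_measurable_const])
  moreover have "{s \<in> space ?M. ?h s > \<epsilon>} = {s \<in> D. frob_norm (f s - g s) > \<epsilon>}"
    using f g by (auto simp: space_restrict_space mat_measurable_on_def frob_norm_minus[of _ p])
  ultimately show ?thesis using D by (simp add: sets_restrict_space_iff)
qed

text \<open>Where \<open>f s\<close> is not Hermitian, it keeps a positive distance from all the
  Hermitian matrices \<open>g t s\<close>. Such a point lies for some \<open>k\<close> in every
  \<open>E t k\<close>, and the measure of this intersection is at most that of each
  \<open>E t k\<close>, which tends to 0. No almost everywhere convergent subsequence has to be
  extracted.\<close>

lemma null_sets_limit_not_hermitian:
  assumes D: "D \<in> fmeasurable lebesgue" and f: "mat_measurable_on p D f"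
    and g: "\<And>t :: nat. mat_measurable_on p D (g t)"
    and herm: "\<And>t s. s \<in> D \<Longrightarrow> hermitian_mat p (g t s)"
    and conv: "\<And>\<epsilon>. \<epsilon> > 0 \<Longrightarrow> (\<lambda>t. measure lebesgue {s \<in> D. frob_norm (g t s - f s) > \<epsilon>}) \<longlonglongrightarrow> 0"
  shows "{s \<in> D. \<not> hermitian_mat p (f s)} \<in> null_sets lebesgue"
proof -
  define E where "E t k = {s \<in> D. frob_norm (g t s - f s) > inverse (real (Suc k))}" for t k
  have E: "E t k \<in> fmeasurable lebesgue" for t k
  proof (rule fmeasurableI2[OF D])
    show "E t k \<in> sets lebesgue"
      unfolding E_def by (rule sets_frob_norm_greater[OF fmeasurableD[OF D] g f])
  qed (auto simp: E_def)
  have "(\<Inter>t. E t k) \<in> null_sets lebesgue" for k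
  proof -
    have s: "(\<Inter>t. E t k) \<in> sets lebesgue" using E by (intro sets.countable_INT) (auto dest: fmeasurableD)
    have fm: "(\<Inter>t. E t k) \<in> fmeasurable lebesgue" by (rule fmeasurableI2[OF E[of 0 k] _ s]) auto
    have "measure lebesgue (\<Inter>t. E t k) \<le> measure lebesgue (E t k)" for t
      by (intro measure_mono_fmeasurable s E) auto
    moreover have "(\<lambda>t. measure lebesgue (E t k)) \<longlonglongrightarrow> 0" unfolding E_def by (rule conv) simp
    ultimately have "measure lebesgue (\<Inter>t. E t k) \<le> 0" by (intro LIMSEQ_le_const) auto
    then have "measure lebesgue (\<Inter>t. E t k) = 0" by (simp add: measure_le_0_iff)
    then show ?thesis using fm by (simp add: null_sets_def s emeasure_eq_measure2)
  qed
  then have "(\<Union>k. \<Inter>t. E t k) \<in> null_sets lebesgue" by (intro null_sets_UN) auto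
  moreover have "{s \<in> D. \<not> hermitian_mat p (f s)} \<subseteq> (\<Union>k. \<Inter>t. E t k)"
  proof (rule subsetI, rule ccontr)
    fix s assume "s \<in> {s \<in> D. \<not> hermitian_mat p (f s)}" and n: "s \<notin> (\<Union>k. \<Inter>t. E t k)"
    then have s: "s \<in> D" and nh: "\<not> hermitian_mat p (f s)" by auto
    have ns: "\<exists>t. s \<notin> E t k" for k using n by auto
    have fs: "f s \<in> carrier_mat p p" using f s by (auto simp: mat_measurable_on_def)
    have "f s $$ (i, j) = cnj (f s $$ (j, i))" if ij: "i < p" "j < p" for i j
    proof -
      have "cmod (f s $$ (i, j) - cnj (f s $$ (j, i))) \<le> 2 * inverse (real (Suc k))" for k
      proof -
        obtain t where "s \<notin> E t k" using ns by blast
        then have fr: "frob_norm (g t s - f s) \<le> inverse (real (Suc k))" using s by (auto simp: E_def)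
        have gs: "g t s \<in> carrier_mat p p" using g s by (auto simp: mat_measurable_on_def)
        have b: "cmod (g t s $$ (i, j) - f s $$ (i, j)) \<le> inverse (real (Suc k))"
          "cmod (g t s $$ (j, i) - f s $$ (j, i)) \<le> inverse (real (Suc k))"
          using cmod_index_le_frob_norm[OF minus_carrier_mat[OF fs, of "g t s"], of i j]
            cmod_index_le_frob_norm[OF minus_carrier_mat[OF fs, of "g t s"], of j i] fr gs fs ij by auto
        \<comment> \<open>Since \<open>g t s\<close> is Hermitian, the Hermitian defect of
          \<open>f s\<close> equals that of \<open>f s - g t s\<close>, hence is at most twice the
          distance.\<close>
        have eq: "f s $$ (i, j) - cnj (f s $$ (j, i))
            = cnj (g t s $$ (j, i) - f s $$ (j, i)) - (g t s $$ (i, j) - f s $$ (i, j))"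
          using hermitian_mat_index[OF herm[OF s, of t] ij] by simp
        show ?thesis
          unfolding eq using b
            norm_triangle_ineq4[of "cnj (g t s $$ (j, i) - f s $$ (j, i))" "g t s $$ (i, j) - f s $$ (i, j)"]
          unfolding complex_mod_cnj by linarith
      qed
      moreover have "(\<lambda>k. 2 * inverse (real (Suc k))) \<longlonglongrightarrow> 2 * 0"
        by (intro tendsto_intros LIMSEQ_inverse_real_of_nat)
      ultimately have "cmod (f s $$ (i, j) - cnj (f s $$ (j, i))) \<le> 2 * 0"
        by (intro LIMSEQ_le_const) blast+
      then show ?thesis by simp
    qed
    then show False using nh hermitian_matI[OF fs] by blast
  qed
  ultimately show ?thesis by (rule null_sets_completion_subset[rotated])
qed

text \<open>Completeness of Lebesgue measure makes the part of a preimage inside \<open>N\<close>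
  measurable. This serves the limit symbol, which is Hermitian only outside a null set.\<close>

lemma borel_measurable_lebesgue_spike:
  fixes u v :: "'a::euclidean_space \<Rightarrow> 'b::topological_space"
  assumes v: "v \<in> borel_measurable lebesgue" and N: "N \<in> null_sets lebesgue"
    and eq: "\<And>x. x \<notin> N \<Longrightarrow> u x = v x"
  shows "u \<in> borel_measurable lebesgue"
proof (rule measurableI)
  fix A :: "'b set" assume A: "A \<in> sets borel"
  have "u -` A \<inter> N \<in> null_sets lebesgue" by (rule null_sets_completion_subset[OF _ N]) auto
  then have "(v -` A \<inter> space lebesgue - N) \<union> (u -` A \<inter> N) \<in> sets lebesgue"
    using measurable_sets[OF v A] N by (intro sets.Un sets.Diff) auto
  also have "(v -` A \<inter> space lebesgue - N) \<union> (u -` A \<inter> N) = u -` A \<inter> space lebesgue"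
    using eq by auto
  finally show "u -` A \<inter> space lebesgue \<in> sets lebesgue" .
qed simp

text \<open>Split \<open>D\<close> into \<open>E t\<close>, where the difference is bounded by
  \<open>B\<close> and the measure tends to 0, and the rest, where it is at most
  \<open>\<epsilon>\<close>. The sets \<open>E t\<close> may depend on
  \<open>\<epsilon>\<close>.\<close>

lemma integral_tendsto_of_measure:
  fixes u :: "nat \<Rightarrow> 'a \<Rightarrow> complex"
  assumes D: "D \<in> fmeasurable M" and int: "\<And>t. integrable M (u t)" "integrable M v"
    and bd: "\<And>t. AE x in M. norm (u t x - v x) \<le> B * indicator D x"
    and close: "\<And>\<epsilon>. \<epsilon> > 0 \<Longrightarrow> \<exists>E. (\<forall>t. E t \<in> fmeasurable M) \<and> (\<lambda>t. measure M (E t)) \<longlonglongrightarrow> 0 \<and>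
      (\<forall>t. AE x in M. x \<in> D - E t \<longrightarrow> norm (u t x - v x) \<le> \<epsilon>)"
  shows "(\<lambda>t. integral\<^sup>L M (u t)) \<longlonglongrightarrow> integral\<^sup>L M v"
proof (rule LIMSEQ_I)
  fix r :: real assume r: "r > 0"
  \<comment> \<open>Half of \<open>r\<close> is reserved for the part outside \<open>E t\<close>;
    the summand 1 allows \<open>D\<close> to have measure 0.\<close>
  define \<epsilon> where "\<epsilon> = r / 2 / (measure M D + 1)"
  have D1: "measure M D + 1 > 0" by (simp add: add_nonneg_pos)
  have \<epsilon>: "\<epsilon> > 0" using r D1 by (simp add: \<epsilon>_def)
  have "\<epsilon> * measure M D \<le> \<epsilon> * (measure M D + 1)" using \<epsilon> by simp
  also have "\<dots> = r / 2" using D1 unfolding \<epsilon>_def by (metis less_irrefl nonzero_eq_divide_eq)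
  finally have \<epsilon>D: "\<epsilon> * measure M D \<le> r / 2" .
  obtain E where E: "\<And>t. E t \<in> fmeasurable M" "(\<lambda>t. measure M (E t)) \<longlonglongrightarrow> 0"
    and cl: "\<And>t. AE x in M. x \<in> D - E t \<longrightarrow> norm (u t x - v x) \<le> \<epsilon>"
    using close[OF \<epsilon>] by blast
  have ineq: "norm (integral\<^sup>L M (u t) - integral\<^sup>L M v) \<le> \<epsilon> * measure M D + \<bar>B\<bar> * measure M (E t)" for t
  proof -
    have i: "integrable M (\<lambda>x. \<epsilon> * indicator D x + \<bar>B\<bar> * indicator (E t) x)"
      using D E(1)[of t] by (auto simp: fmeasurable_def)
    have "norm (integral\<^sup>L M (u t) - integral\<^sup>L M v) = norm (\<integral>x. u t x - v x \<partial>M)"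
      using int by simp
    also have "\<dots> \<le> (\<integral>x. norm (u t x - v x) \<partial>M)" by (rule integral_norm_bound)
    also have "\<dots> \<le> (\<integral>x. \<epsilon> * indicator D x + \<bar>B\<bar> * indicator (E t) x \<partial>M)"
    proof (rule integral_mono_AE[OF _ i])
      show "integrable M (\<lambda>x. norm (u t x - v x))" using int by auto
      show "AE x in M. norm (u t x - v x) \<le> \<epsilon> * indicator D x + \<bar>B\<bar> * indicator (E t) x"
        using bd[of t] cl[of t]
      proof eventually_elim
        case (elim x)
        then show ?case using \<epsilon> by (auto simp: indicator_def split: if_splits)
      qed
    qed
    also have "\<dots> = \<epsilon> * measure M D + \<bar>B\<bar> * measure M (E t)"
      using D E(1)[of t] by (subst Bochner_Integration.integral_add) (auto simp: fmeasurable_def sets.sets_into_space Int_absorb2)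
    finally show ?thesis .
  qed
  have "(\<lambda>t. \<bar>B\<bar> * measure M (E t)) \<longlonglongrightarrow> \<bar>B\<bar> * 0" by (intro tendsto_intros E(2))
  then have "\<forall>\<^sub>F t in sequentially. \<bar>B\<bar> * measure M (E t) < r / 2"
    using r by (intro order_tendstoD(2)) auto
  then obtain t0 where "\<And>t. t \<ge> t0 \<Longrightarrow> \<bar>B\<bar> * measure M (E t) < r / 2"
    by (auto simp: eventually_sequentially)
  then show "\<exists>t0. \<forall>t\<ge>t0. norm (integral\<^sup>L M (u t) - integral\<^sup>L M v) < r"
    using ineq \<epsilon>D by (intro exI[of _ t0]) (smt (verit) field_sum_of_halves)
qed

text \<open>The exceptional set consists of the points where the extended symbols differ by more
  than \<open>\<delta>\<close> and of \<open>D - Dt t\<close>. Both have measure tending to 0, and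
  elsewhere \<open>eig_sum_perturb\<close> with \<open>r = 0\<close> compares the integrands.
  Monotonicity of the sets enters only through \<open>Dt_lim\<close>.\<close>

lemma symbol_integral_tendsto:
  fixes Dt :: "nat \<Rightarrow> 'a::euclidean_space set"
  assumes F: "F \<in> Cc" and p_pos: "p > 0"
    and Dt_meas: "\<And>t. Dt t \<in> sets lebesgue"
    and ft_meas: "\<And>t. mat_measurable_on p (Dt t) (ft t)"
    and ft_herm: "\<And>t s. s \<in> Dt t \<Longrightarrow> hermitian_mat p (ft t s)"
    and Dt_lim: "(\<lambda>t. measure lebesgue (Dt t)) \<longlonglongrightarrow> measure lebesgue (\<Union>t. Dt t)"
    and D_fin: "emeasure lebesgue (\<Union>t. Dt t) < \<infinity>"
    and f_meas: "mat_measurable_on p (\<Union>t. Dt t) f"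
    and conv: "\<And>\<epsilon>. \<epsilon> > 0 \<Longrightarrow>
        (\<lambda>t. measure lebesgue {s \<in> (\<Union>t. Dt t).
            frob_norm ((if s \<in> Dt t then ft t s else 0\<^sub>m p p) - f s) > \<epsilon>}) \<longlonglongrightarrow> 0"
  shows "(\<lambda>t. LINT s : Dt t | lebesgue. eig_sum F (ft t s) / of_nat p)
    \<longlonglongrightarrow> (LINT s : (\<Union>t. Dt t) | lebesgue. eig_sum F (f s) / of_nat p)"
proof -
  define D where "D = (\<Union>t. Dt t)"
  have Dm: "D \<in> sets lebesgue" unfolding D_def using Dt_meas by auto
  have D: "D \<in> fmeasurable lebesgue" using Dm D_fin by (auto simp: D_def fmeasurable_def)
  have sub: "Dt t \<subseteq> D" for t by (auto simp: D_def)
  define fE where "fE t s = (if s \<in> Dt t then ft t s else 0\<^sub>m p p)" for t s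
  have fE_meas: "mat_measurable_on p D (fE t)" for t
    unfolding fE_def by (rule mat_measurable_on_extend_zero[OF Dt_meas Dm sub ft_meas])
  have fE_herm: "hermitian_mat p (fE t s)" for t s
    using ft_herm hermitian_mat_zero by (auto simp: fE_def)
  have fm: "mat_measurable_on p D f" using f_meas by (simp add: D_def)
  have cv: "(\<lambda>t. measure lebesgue {s \<in> D. frob_norm (fE t s - f s) > \<epsilon>}) \<longlonglongrightarrow> 0" if "\<epsilon> > 0" for \<epsilon>
    using conv[OF that] by (simp add: D_def fE_def)
  define N where "N = {s \<in> D. \<not> hermitian_mat p (f s)}"
  have N: "N \<in> null_sets lebesgue"
    unfolding N_def by (rule null_sets_limit_not_hermitian[OF D fm fE_meas fE_herm cv])
  then have Nm: "N \<in> sets lebesgue" by auto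
  obtain K where K: "K \<ge> 0" "\<And>x. norm (F x) \<le> K" using Cc_bounded[OF F] by blast
  have eb: "norm (eig_sum F X / of_nat p) \<le> K" if "hermitian_mat p X" for X
    using norm_eig_sum_le[OF that K(2)] p_pos by (simp add: norm_divide divide_le_eq)
  \<comment> \<open>\<open>u t\<close> is 0 outside \<open>Dt t\<close>, unlike the normalised
    eigenvalue sum of the extension \<open>fE t\<close>, which is \<open>F 0\<close> there. The
    discrepancy is absorbed by including \<open>D - Dt t\<close> in the exceptional set.\<close>
  define u where "u t x = indicator (Dt t) x *\<^sub>R (eig_sum F (ft t x) / of_nat p)" for t x
  define v where "v x = indicator D x *\<^sub>R (eig_sum F (f x) / of_nat p)" for x
  have um: "u t \<in> borel_measurable lebesgue" for t
    unfolding u_def using Dt_meas borel_measurable_eig_sum[OF F ft_meas ft_herm, of t]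
    by (subst borel_measurable_restrict_space_iff[symmetric]) auto
  have vm: "v \<in> borel_measurable lebesgue"
  proof (rule borel_measurable_lebesgue_spike[OF _ N])
    \<comment> \<open>Without \<open>N\<close> the symbol is Hermitian everywhere, so
      \<open>borel_measurable_eig_sum\<close> applies; changing the integrand on \<open>N\<close>
      preserves measurability.\<close>
    have "mat_measurable_on p (D - N) f"
      using fm by (auto simp: mat_measurable_on_def intro: measurable_restrict_mono[of _ _ D])
    then have "(\<lambda>s. eig_sum F (f s)) \<in> borel_measurable (restrict_space lebesgue (D - N))"
      by (rule borel_measurable_eig_sum[OF F]) (auto simp: N_def)
    then show "(\<lambda>x. indicator (D - N) x *\<^sub>R (eig_sum F (f x) / of_nat p)) \<in> borel_measurable lebesgue"
      using Dm Nm by (subst borel_measurable_restrict_space_iff[symmetric]) auto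
    show "v x = indicator (D - N) x *\<^sub>R (eig_sum F (f x) / of_nat p)" if "x \<notin> N" for x
      using that by (simp add: v_def indicator_def)
  qed
  have ub: "norm (u t x) \<le> K * indicator D x" for t x
    using eb[OF ft_herm, of x t] K(1) sub[of t] by (auto simp: u_def indicator_def)
  have vb: "norm (v x) \<le> K * indicator D x" if "x \<notin> N" for x
    using that eb[of "f x"] by (auto simp: v_def indicator_def N_def)
  have AEN: "AE x in lebesgue. x \<notin> N" using N by (rule AE_not_in)
  have iK: "integrable lebesgue (\<lambda>x. K * indicator D x)"
    using D by (auto simp: fmeasurable_def)
  have ui: "integrable lebesgue (u t)" for t
    using K(1) ub[of t] by (intro Bochner_Integration.integrable_bound[OF iK um]) auto
  have vi: "integrable lebesgue v"
  proof (rule Bochner_Integration.integrable_bound[OF iK vm])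
    show "AE x in lebesgue. norm (v x) \<le> norm (K * indicator D x)"
      using AEN by eventually_elim (use vb K(1) in auto)
  qed
  have "(\<lambda>t. integral\<^sup>L lebesgue (u t)) \<longlonglongrightarrow> integral\<^sup>L lebesgue v"
  proof (rule integral_tendsto_of_measure[OF D ui vi, where B = "2 * K"])
    fix t
    show "AE x in lebesgue. norm (u t x - v x) \<le> 2 * K * indicator D x"
      using AEN
    proof eventually_elim
      case (elim x)
      show ?case using norm_triangle_ineq4[of "u t x" "v x"] ub[of t x] vb[OF elim] by linarith
    qed
  next
    fix \<epsilon> :: real assume \<epsilon>: "\<epsilon> > 0"
    obtain C where C0: "C \<ge> 0" and C: "\<And>n X Y r w. \<lbrakk>hermitian_mat n X; hermitian_mat n Y; forms_close n r w X Y; 0 \<le> w\<rbrakk>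
      \<Longrightarrow> norm (eig_sum F X - eig_sum F Y) \<le> \<epsilon> / 2 * real n + C * (w * real n + real r)"
      using eig_sum_perturb[OF F half_gt_zero[OF \<epsilon>]] by blast
    \<comment> \<open>Chosen so that \<open>C * \<delta> \<le> \<epsilon> / 2\<close>; adding 1 to
      \<open>C\<close> covers the case \<open>C = 0\<close>.\<close>
    define \<delta> where "\<delta> = \<epsilon> / (2 * (C + 1))"
    have \<delta>: "\<delta> > 0" using \<epsilon> C0 by (simp add: \<delta>_def)
    have C\<delta>: "C * \<delta> \<le> \<epsilon> / 2"
      using \<epsilon> C0 by (simp add: \<delta>_def field_simps)
    define E1 where "E1 t = {s \<in> D. frob_norm (fE t s - f s) > \<delta>}" for t
    define E where "E t = E1 t \<union> (D - Dt t)" for t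
    have E1: "E1 t \<in> fmeasurable lebesgue" for t
    proof (rule fmeasurableI2[OF D])
      show "E1 t \<in> sets lebesgue" unfolding E1_def by (rule sets_frob_norm_greater[OF Dm fE_meas fm])
    qed (auto simp: E1_def)
    have E2: "D - Dt t \<in> fmeasurable lebesgue" for t using D Dt_meas by (rule fmeasurable_Diff)
    have "(\<lambda>t. measure lebesgue (E t)) \<longlonglongrightarrow> 0"
    proof (rule tendsto_sandwich[OF _ _ tendsto_const])
      show "\<forall>\<^sub>F t in sequentially. measure lebesgue (E t)
          \<le> measure lebesgue (E1 t) + (measure lebesgue D - measure lebesgue (Dt t))"
      proof (intro always_eventually allI)
        fix t
        have "measure lebesgue (D - Dt t) = measure lebesgue D - measure lebesgue (Dt t)"
          using D Dt_meas[of t] sub[of t] by (intro measurable_measure_Diff) auto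
        then show "measure lebesgue (E t)
          \<le> measure lebesgue (E1 t) + (measure lebesgue D - measure lebesgue (Dt t))"
          unfolding E_def using measure_Un_le[of "E1 t" lebesgue "D - Dt t"] E1[of t] E2[of t]
          by (auto dest: fmeasurableD)
      qed
      have "(\<lambda>t. measure lebesgue (E1 t) + (measure lebesgue D - measure lebesgue (Dt t)))
          \<longlonglongrightarrow> 0 + (measure lebesgue D - measure lebesgue D)"
        unfolding E1_def using Dt_lim by (intro tendsto_intros cv[OF \<delta>]) (simp add: D_def)
      then show "(\<lambda>t. measure lebesgue (E1 t) + (measure lebesgue D - measure lebesgue (Dt t))) \<longlonglongrightarrow> 0"
        by simp
    qed simp
    moreover have "E t \<in> fmeasurable lebesgue" for t
      unfolding E_def using E1 E2 by (rule fmeasurable.Un)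
    moreover have "AE x in lebesgue. x \<in> D - E t \<longrightarrow> norm (u t x - v x) \<le> \<epsilon>" for t
      using AEN
    proof eventually_elim
      case (elim x)
      show ?case
      proof
        assume x: "x \<in> D - E t"
        then have xD: "x \<in> D" "x \<in> Dt t" and fr: "frob_norm (ft t x - f x) \<le> \<delta>"
          by (auto simp: E_def E1_def fE_def)
        have h: "hermitian_mat p (ft t x)" "hermitian_mat p (f x)"
          using ft_herm[OF xD(2)] elim xD(1) by (auto simp: N_def)
        then have "forms_close p 0 (frob_norm (ft t x - f x)) (ft t x) (f x)"
          by (intro forms_close_frob_norm) (auto simp: hermitian_mat_def)
        from C[OF h this frob_norm_nonneg]
        have "norm (eig_sum F (ft t x) - eig_sum F (f x)) \<le> (\<epsilon> / 2 + C * frob_norm (ft t x - f x)) * real p"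
          by (simp add: algebra_simps)
        also have "\<dots> \<le> \<epsilon> * real p"
        proof (rule mult_right_mono)
          have "C * frob_norm (ft t x - f x) \<le> C * \<delta>" by (rule mult_left_mono[OF fr C0])
          then show "\<epsilon> / 2 + C * frob_norm (ft t x - f x) \<le> \<epsilon>" using C\<delta> by linarith
        qed simp
        finally have "norm ((eig_sum F (ft t x) - eig_sum F (f x)) / of_nat p) \<le> \<epsilon>"
          using p_pos by (simp add: norm_divide divide_le_eq)
        then show "norm (u t x - v x) \<le> \<epsilon>" using xD by (simp add: u_def v_def diff_divide_distrib)
      qed
    qed
    ultimately show "\<exists>E. (\<forall>t. E t \<in> fmeasurable lebesgue) \<and> (\<lambda>t. measure lebesgue (E t)) \<longlonglongrightarrow> 0 \<and>
      (\<forall>t. AE x in lebesgue. x \<in> D - E t \<longrightarrow> norm (u t x - v x) \<le> \<epsilon>)" by blast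
  qed
  then show ?thesis unfolding set_lebesgue_integral_def u_def v_def D_def .
qed

text \<open>Three errors arise: the low rank and small norm terms cost
  \<open>\<epsilon> / 2 + C * (\<omega> t + c t)\<close>, the padding zeros cost
  \<open>K * m t\<close>, and dividing by \<open>dB t n\<close> in place of \<open>d n\<close> costs
  another \<open>K * m t\<close>. All bounds are uniform in \<open>n\<close> beyond
  \<open>nt\<close>, so \<open>t\<close> can be fixed first.\<close>

lemma gacs_eig_sum_close:
  assumes F: "F \<in> Cc" and herm: "\<And>n. hermitian_mat (d n) (A n)" and d_pos: "\<And>n. d n > 0"
    and gacs: "gacs_herm B dB A d" and \<epsilon>: "\<epsilon> > 0"
  shows "\<forall>\<^sub>F t in sequentially. \<forall>\<^sub>F n in sequentially.
    norm (eig_sum F (A n) / of_nat (d n) - eig_sum F (B t n) / of_nat (dB t n)) < \<epsilon>"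
proof -
  obtain c \<omega> m where lim: "c \<longlonglongrightarrow> 0" "\<omega> \<longlonglongrightarrow> 0" "m \<longlonglongrightarrow> 0"
    and dec: "\<And>t. \<exists>nt. \<forall>n>nt. \<exists>U R N.
          unitary_mat (d n) U \<and> R \<in> carrier_mat (d n) (d n) \<and> N \<in> carrier_mat (d n) (d n) \<and>
          A n = U * pad_zero (d n) (B t n) * mat_adjoint U + R + N \<and>
          real (mat_rank (d n) R) \<le> c t * real (d n) \<and>
          spec_norm N \<le> \<omega> t \<and>
          real (d n - dB t n) \<le> m t * real (d n)"
    and Bh: "\<And>t n. hermitian_mat (dB t n) (B t n)" and dB: "\<And>t n. dB t n \<le> d n"
    using gacs unfolding gacs_herm_def by blast
  obtain K where K: "K \<ge> 0" "\<And>x. norm (F x) \<le> K" using Cc_bounded[OF F] by blast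
  obtain C where C0: "C \<ge> 0" and C: "\<And>n X Y r w. \<lbrakk>hermitian_mat n X; hermitian_mat n Y; forms_close n r w X Y; 0 \<le> w\<rbrakk>
    \<Longrightarrow> norm (eig_sum F X - eig_sum F Y) \<le> \<epsilon> / 2 * real n + C * (w * real n + real r)"
    using eig_sum_perturb[OF F half_gt_zero[OF \<epsilon>]] by blast
  have "(\<lambda>t. \<epsilon> / 2 + C * (\<omega> t + c t) + 2 * K * m t) \<longlonglongrightarrow> \<epsilon> / 2 + C * (0 + 0) + 2 * K * 0"
    by (intro tendsto_intros lim)
  from order_tendstoD(2)[OF this, of \<epsilon>]
  have "\<forall>\<^sub>F t in sequentially. \<epsilon> / 2 + C * (\<omega> t + c t) + 2 * K * m t < \<epsilon>" using \<epsilon> by simp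
  then show ?thesis
  proof eventually_elim
    case (elim t)
    obtain nt where nt: "\<And>n. n > nt \<Longrightarrow> \<exists>U R N.
          unitary_mat (d n) U \<and> R \<in> carrier_mat (d n) (d n) \<and> N \<in> carrier_mat (d n) (d n) \<and>
          A n = U * pad_zero (d n) (B t n) * mat_adjoint U + R + N \<and>
          real (mat_rank (d n) R) \<le> c t * real (d n) \<and>
          spec_norm N \<le> \<omega> t \<and>
          real (d n - dB t n) \<le> m t * real (d n)"
      using dec[of t] by blast
    have "norm (eig_sum F (A n) / of_nat (d n) - eig_sum F (B t n) / of_nat (dB t n)) < \<epsilon>" if n: "n > nt" for n
    proof -
      obtain U R N where U: "unitary_mat (d n) U" and R: "R \<in> carrier_mat (d n) (d n)"
        and N: "N \<in> carrier_mat (d n) (d n)"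
        and An: "A n = U * pad_zero (d n) (B t n) * mat_adjoint U + R + N"
        and rk: "real (mat_rank (d n) R) \<le> c t * real (d n)" and sn: "spec_norm N \<le> \<omega> t"
        and md: "real (d n - dB t n) \<le> m t * real (d n)"
        using nt[OF n] by blast
      let ?d = "real (d n)" and ?k = "real (d n - dB t n)"
      let ?Y = "U * pad_zero (d n) (B t n) * mat_adjoint U"
      have d0: "?d > 0" using d_pos by simp
      have Yh: "hermitian_mat (d n) ?Y"
        and Ye: "eig_sum F ?Y = eig_sum F (B t n) + of_nat (d n - dB t n) * F 0"
        using pad_zero_unitary_diag[OF Bh dB U] by auto
      have "forms_close (d n) (mat_rank (d n) R) (spec_norm N) (A n) ?Y"
        unfolding An using Yh R N by (intro forms_close_rank_norm) (auto simp: hermitian_mat_def)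
      from C[OF herm Yh this spec_norm_nonneg[OF N d_pos]]
      have "norm (eig_sum F (A n) - eig_sum F ?Y) \<le> \<epsilon> / 2 * ?d + C * (spec_norm N * ?d + real (mat_rank (d n) R))" .
      also have "\<dots> \<le> \<epsilon> / 2 * ?d + C * (\<omega> t * ?d + c t * ?d)"
        using C0 rk sn by (intro add_left_mono mult_left_mono add_mono mult_right_mono) auto
      also have "\<dots> = (\<epsilon> / 2 + C * (\<omega> t + c t)) * ?d" by (simp add: algebra_simps)
      finally have "norm ((eig_sum F (A n) - eig_sum F ?Y) / of_nat (d n)) \<le> \<epsilon> / 2 + C * (\<omega> t + c t)"
        using d0 by (simp add: norm_divide divide_le_eq)
      moreover have "norm (of_nat (d n - dB t n) * F 0 / of_nat (d n)) \<le> K * m t"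
      proof -
        have "?k * norm (F 0) \<le> (m t * ?d) * K" using md K by (intro mult_mono) auto
        then show ?thesis using d0 by (simp add: norm_divide norm_mult divide_le_eq mult_ac)
      qed
      moreover have "norm (eig_sum F (B t n) / of_nat (d n) - eig_sum F (B t n) / of_nat (dB t n)) \<le> K * m t"
      \<comment> \<open>For \<open>dB t n = 0\<close> the eigenvalue sum is empty and both quotients
        are 0, while \<open>md\<close> gives \<open>m t \<ge> 1\<close>, so the right-hand side is
        nonnegative.\<close>
      proof (cases "dB t n = 0")
        case True
        then have "eig_sum F (B t n) = 0" using norm_eig_sum_le[OF Bh[of t n] K(2)] by simp
        then show ?thesis using md d0 K(1) True by simp
      next
        case False
        let ?b = "real (dB t n)"
        have b0: "?b > 0" using False by simp
        have "eig_sum F (B t n) / of_nat (d n) - eig_sum F (B t n) / of_nat (dB t n)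
            = eig_sum F (B t n) * complex_of_real (1 / ?d - 1 / ?b)"
          by (simp add: right_diff_distrib)
        also have "norm \<dots> = norm (eig_sum F (B t n)) * (?k / (?d * ?b))"
          using b0 d0 dB[of t n] unfolding norm_mult norm_of_real
          by (simp add: of_nat_diff field_simps abs_if)
        \<comment> \<open>The bound \<open>K * ?b\<close> on the eigenvalue sum cancels the factor
          \<open>?b\<close> in the denominator, so the estimate survives small
          \<open>dB t n\<close>.\<close>
        also have "\<dots> \<le> (K * ?b) * ((m t * ?d) / (?d * ?b))"
          using norm_eig_sum_le[OF Bh[of t n] K(2)] md b0 d0 K(1)
          by (intro mult_mono divide_right_mono) auto
        also have "\<dots> = K * m t" using b0 d0 by simp
        finally show ?thesis .
      qed
      moreover have "eig_sum F (A n) / of_nat (d n) - eig_sum F (B t n) / of_nat (dB t n)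
          = (eig_sum F (A n) - eig_sum F ?Y) / of_nat (d n) + of_nat (d n - dB t n) * F 0 / of_nat (d n)
            + (eig_sum F (B t n) / of_nat (d n) - eig_sum F (B t n) / of_nat (dB t n))"
        unfolding Ye by (simp add: add_divide_distrib diff_divide_distrib)
      ultimately have "norm (eig_sum F (A n) / of_nat (d n) - eig_sum F (B t n) / of_nat (dB t n))
          \<le> (\<epsilon> / 2 + C * (\<omega> t + c t)) + K * m t + K * m t"
        by (smt (verit) norm_triangle_ineq)
      then show ?thesis using elim by simp
    qed
    then show ?case by (auto simp: eventually_sequentially intro!: exI[of _ "Suc nt"])
  qed
qed

theorem theorem4p4:
  fixes A :: "nat \<Rightarrow> complex mat" and d :: "nat \<Rightarrow> nat"
    and B :: "nat \<Rightarrow> nat \<Rightarrow> complex mat" and dB :: "nat \<Rightarrow> nat \<Rightarrow> nat"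
    and p :: nat
    and Dt :: "nat \<Rightarrow> 'a::euclidean_space set"
    and ft :: "nat \<Rightarrow> 'a \<Rightarrow> complex mat"
    and f :: "'a \<Rightarrow> complex mat"
  assumes herm: "\<And>n. hermitian_mat (d n) (A n)"
    and d_mono: "mono d" and d_pos: "\<And>n. d n > 0"
    and gacs: "gacs_herm B dB A d"
    and p_pos: "p > 0"
    and Dt_meas: "\<And>t. Dt t \<in> sets lebesgue"
    and Dt_pos: "\<And>t. 0 < emeasure lebesgue (Dt t)"
    and Dt_fin: "\<And>t. emeasure lebesgue (Dt t) < \<infinity>"
    and ft_meas: "\<And>t. mat_measurable_on p (Dt t) (ft t)"
    and ft_herm: "\<And>t s. s \<in> Dt t \<Longrightarrow> hermitian_mat p (ft t s)"
    and distr: "\<And>t F. F \<in> Cc \<Longrightarrow>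
        (\<lambda>n. eig_sum F (B t n) / of_nat (dB t n)) \<longlonglongrightarrow>
          (1 / measure lebesgue (Dt t)) *\<^sub>R (LINT s : Dt t | lebesgue. eig_sum F (ft t s) / of_nat p)"
    and nested: "\<And>t. Dt t \<subseteq> Dt (Suc t)"
    and D_fin: "emeasure lebesgue (\<Union>t. Dt t) < \<infinity>"
    and f_meas: "mat_measurable_on p (\<Union>t. Dt t) f"
    and conv: "\<And>\<epsilon>. \<epsilon> > 0 \<Longrightarrow>
        (\<lambda>t. measure lebesgue {s \<in> (\<Union>t. Dt t).
            frob_norm ((if s \<in> Dt t then ft t s else 0\<^sub>m p p) - f s) > \<epsilon>}) \<longlonglongrightarrow> 0"
  shows "\<And>F. F \<in> Cc \<Longrightarrow>
      (\<lambda>n. eig_sum F (A n) / of_nat (d n)) \<longlonglongrightarrow>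
        (1 / measure lebesgue (\<Union>t. Dt t)) *\<^sub>R (LINT s : (\<Union>t. Dt t) | lebesgue. eig_sum F (f s) / of_nat p)"
proof -
  fix F assume F: "F \<in> Cc"
  let ?D = "\<Union>t. Dt t"
  have "incseq Dt" using nested by (rule incseq_SucI)
  then have Dt_lim: "(\<lambda>t. measure lebesgue (Dt t)) \<longlonglongrightarrow> measure lebesgue ?D"
    using Dt_meas D_fin by (intro Lim_measure_incseq) auto
  have "0 < emeasure lebesgue ?D"
    using Dt_pos[of 0] by (rule less_le_trans) (use Dt_meas in \<open>intro emeasure_mono, auto\<close>)
  \<comment> \<open>Needed to pass to the limit in the factor
    \<open>1 / measure lebesgue (Dt t)\<close>.\<close>
  then have D_pos: "measure lebesgue ?D \<noteq> 0"
    using D_fin by (auto simp: measure_def enn2real_eq_0_iff)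
  define L where "L t = (1 / measure lebesgue (Dt t)) *\<^sub>R (LINT s : Dt t | lebesgue. eig_sum F (ft t s) / of_nat p)" for t
  define l where "l = (1 / measure lebesgue ?D) *\<^sub>R (LINT s : ?D | lebesgue. eig_sum F (f s) / of_nat p)"
  have L: "L \<longlonglongrightarrow> l"
    unfolding L_def l_def
    by (intro tendsto_intros Dt_lim D_pos
        symbol_integral_tendsto[OF F p_pos Dt_meas ft_meas ft_herm Dt_lim D_fin f_meas conv])
  have "(\<lambda>n. eig_sum F (A n) / of_nat (d n)) \<longlonglongrightarrow> l"
  proof (rule tendstoI)
    fix e :: real assume e: "e > 0"
    then have e3: "e / 3 > 0" by simp
    have "\<forall>\<^sub>F t in sequentially. dist (L t) l < e / 3" using L e3 by (rule tendstoD)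
    then have "\<forall>\<^sub>F t in sequentially. dist (L t) l < e / 3 \<and> (\<forall>\<^sub>F n in sequentially.
        norm (eig_sum F (A n) / of_nat (d n) - eig_sum F (B t n) / of_nat (dB t n)) < e / 3)"
      using gacs_eig_sum_close[OF F herm d_pos gacs e3] by (rule eventually_conj)
    \<comment> \<open>A single \<open>t\<close> serves both purposes: \<open>L t\<close> is near
      \<open>l\<close>, and the means of \<open>A n\<close> and \<open>B t n\<close> are close for
      all large \<open>n\<close>. With this \<open>t\<close> fixed, the assumed distribution of
      \<open>B t n\<close> supplies the last third of \<open>e\<close>.\<close>
    then obtain t where t: "dist (L t) l < e / 3" "\<forall>\<^sub>F n in sequentially.
        norm (eig_sum F (A n) / of_nat (d n) - eig_sum F (B t n) / of_nat (dB t n)) < e / 3"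
      using eventually_happens'[OF sequentially_bot] by blast
    have "\<forall>\<^sub>F n in sequentially. dist (eig_sum F (B t n) / of_nat (dB t n)) (L t) < e / 3"
      unfolding L_def using distr[OF F] e3 by (rule tendstoD)
    with t(2) show "\<forall>\<^sub>F n in sequentially. dist (eig_sum F (A n) / of_nat (d n)) l < e"
    proof eventually_elim
      case (elim n)
      then show ?case
        using t(1) dist_triangle[of "eig_sum F (A n) / of_nat (d n)" l "L t"]
          dist_triangle[of "eig_sum F (A n) / of_nat (d n)" "L t" "eig_sum F (B t n) / of_nat (dB t n)"]
        unfolding dist_norm[of "eig_sum F (A n) / of_nat (d n)" "eig_sum F (B t n) / of_nat (dB t n)"]
        by linarith
    qed
  qed
  then show "(\<lambda>n. eig_sum F (A n) / of_nat (d n)) \<longlonglongrightarrow>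
        (1 / measure lebesgue (\<Union>t. Dt t)) *\<^sub>R (LINT s : (\<Union>t. Dt t) | lebesgue. eig_sum F (f s) / of_nat p)"
    unfolding l_def .
qed

end
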